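(* The following algorithm is correct. Input: an order $S$ in a $\mathbb{Q}$-étale algebra $K$. Output: a list $\mathcal{L}^w$ of the representatives of the weak equivalence classes of ideals with endomorphism ring (that is, multiplicator ring) $S$, that is, of $\mathcal{W}_S(R)$. Steps: Compute the trace dual ideal $S^t$ and initialize an empty list $\mathcal{L}^w$. If $1\in S^t(S:S^t)$, append $S$ to $\mathcal{L}^w$. Otherwise, find an over-order $T$ of $S$ such that $1\in S^tT(T:S^tT)$ (using an algorithm that computes the over-orders of $S$), put $\mathfrak f:=(S:T)$, and consider the quotient map $q:T\twoheadrightarrow Q:=T/\mathfrak f$; for each subgroup $H'$ of $Q$, let $I$ be the sub-$S$-module of $K$ generated by $q^{-1}(H')$, and if there is no $J\in\mathcal{L}^w$ weakly equivalent to $I$, append $I$ to $\mathcal{L}^w$. Return $\mathcal{L}^w$.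
   Context: An order is a commutative reduced ring $R$ with unit that is free and finitely generated as a $\mathbb{Z}$-module; its total quotient ring $K$ is an étale algebra over $\mathbb{Q}$, i.e. a finite product of number fields, and $R$ is called an order in $K$. A fractional $R$-ideal is a finitely generated sub-$R$-module $I$ of $K$ with $I\otimes_{\mathbb Z}\mathbb{Q}=K$. For fractional ideals $I,J$, $(I:J)=\{x\in K:xJ\subseteq I\}$, and $(I:I)$ is the multiplicator ring of $I$. An over-order of $R$ is a fractional $R$-ideal that is a ring (so it contains $R$). A fractional $S$-ideal $L$ is invertible if $LL'=S$ for some fractional $S$-ideal $L'$. The trace dual of $S$ is $S^t=\{x\in K:\mathrm{Tr}_{K/\mathbb{Q}}(xS)\subseteq\mathbb{Z}\}$. Two fractional $R$-ideals $I,J$ are weakly equivalent if they satisfy the following equivalent conditions: $I_{\mathfrak p}\simeq J_{\mathfrak p}$ for every maximal ideal $\mathfrak p$ of $R$; $1\in (I:J)(J:I)$; $I$ and $J$ have the same multiplicator ring, say $S'$, and $I=LJ$ for some invertible fractional $S'$-ideal $L$. Here $R$ is an order in $K$ of which $S$ is an over-order, and $\mathcal{W}_S(R)$ is the set of weak equivalence classes of fractional $R$-ideals $I$ with $(I:I)=S$.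
   Formalization: As written, the second branch also appends ideals whose multiplicator ring is larger than S (H'=Q gives T), so the output is not a list for W_S(R); proved instead: the entries with (I:I)=S represent W_S(R), and so does the whole output if the loop tests (I:I)=S. *)

theory Defs
  imports Complex_Main "HOL-Algebra.Coset"
begin

text \<open>
  The algebra $K$ is the whole type \<open>'k\<close>; orders and ideals are subsets of it. An etale algebra
  over the rationals, i.e. a finite product of number fields, is expressed as an internal product:
  the idempotents in \<open>E\<close> are the units of the factors $eK$, and each $eK$ is a field of
  finite degree over the rationals. (The zero algebra is excluded by the class \<open>comm_ring_1\<close>.)
\<close>

definition field_factor :: "(rat \<Rightarrow> 'k \<Rightarrow> 'k) \<Rightarrow> 'k::comm_ring_1 \<Rightarrow> bool" where
  "field_factor scl e \<longleftrightarrow>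
     e \<noteq> 0 \<and> e * e = e \<and>
     (\<forall>x. e * x \<noteq> 0 \<longrightarrow> (\<exists>y. (e * x) * (e * y) = e)) \<and>
     (\<exists>B. finite B \<and> module.span scl B = range (\<lambda>x. e * x))"

locale etale_algebra = vector_space scl
  for scl :: "rat \<Rightarrow> 'k::comm_ring_1 \<Rightarrow> 'k" +
  assumes scl_mult: "scl a x * y = scl a (x * y)"
    and product_of_number_fields:
      "\<exists>E. finite E \<and> (\<forall>e\<in>E. field_factor scl e) \<and>
           (\<forall>e\<in>E. \<forall>f\<in>E. e \<noteq> f \<longrightarrow> e * f = 0) \<and> (\<Sum>e\<in>E. e) = 1"

text \<open>Trace of the multiplication map by \<open>x\<close>, read off in some basis (the value does not depend on it).\<close>

definition alg_trace :: "(rat \<Rightarrow> 'k \<Rightarrow> 'k) \<Rightarrow> 'k::comm_ring_1 \<Rightarrow> rat" where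
  "alg_trace scl x =
     (let B = (SOME B. \<not> module.dependent scl B \<and> module.span scl B = UNIV)
      in \<Sum>b\<in>B. module.representation scl B (x * b) b)"


definition submodule_over :: "'k::comm_ring_1 set \<Rightarrow> 'k set \<Rightarrow> bool" where
  "submodule_over R M \<longleftrightarrow>
     0 \<in> M \<and> (\<forall>x\<in>M. \<forall>y\<in>M. x + y \<in> M) \<and> (\<forall>r\<in>R. \<forall>x\<in>M. r * x \<in> M)"

definition gen_submodule :: "'k::comm_ring_1 set \<Rightarrow> 'k set \<Rightarrow> 'k set" where
  "gen_submodule R X = submodule_over R hull X"

definition unital_subring :: "'k::comm_ring_1 set \<Rightarrow> bool" where
  "unital_subring R \<longleftrightarrow>
     1 \<in> R \<and> (\<forall>x\<in>R. \<forall>y\<in>R. x - y \<in> R) \<and> (\<forall>x\<in>R. \<forall>y\<in>R. x * y \<in> R)"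

definition nonzerodivisors :: "'k::comm_ring_1 set \<Rightarrow> 'k set" where
  "nonzerodivisors R = {s \<in> R. \<forall>r\<in>R. r * s = 0 \<longrightarrow> r = 0}"

text \<open>
  \<open>R\<close> is an order in $K$: a subring, free of finite rank as a module over the integers,
  with total quotient ring $K$. Reducedness is inherited from $K$.
\<close>

definition order_in_algebra :: "'k::comm_ring_1 set \<Rightarrow> bool" where
  "order_in_algebra R \<longleftrightarrow>
     unital_subring R \<and>
     (\<exists>B. finite B \<and> \<not> module.dependent (\<lambda>(n::int) (x::'k). of_int n * x) B \<and>
          R = module.span (\<lambda>(n::int) (x::'k). of_int n * x) B) \<and>
     (\<forall>s\<in>nonzerodivisors R. \<exists>y. s * y = 1) \<and>
     (\<forall>x. \<exists>r\<in>R. \<exists>s\<in>nonzerodivisors R. x * s = r)"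

text \<open>
  For $I \subseteq K$ the natural map from $I \otimes \mathbb{Q}$ to $K$ is always injective, and its image is
  the rational span of $I$.
\<close>

definition fractional_ideal ::
  "(rat \<Rightarrow> 'k \<Rightarrow> 'k) \<Rightarrow> 'k::comm_ring_1 set \<Rightarrow> 'k set \<Rightarrow> bool" where
  "fractional_ideal scl R I \<longleftrightarrow>
     (\<exists>X. finite X \<and> I = gen_submodule R X) \<and> module.span scl I = UNIV"

definition over_order ::
  "(rat \<Rightarrow> 'k \<Rightarrow> 'k) \<Rightarrow> 'k::comm_ring_1 set \<Rightarrow> 'k set \<Rightarrow> bool" where
  "over_order scl R T \<longleftrightarrow> fractional_ideal scl R T \<and> unital_subring T"

definition colon :: "'k::comm_ring_1 set \<Rightarrow> 'k set \<Rightarrow> 'k set" where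
  "colon I J = {x. \<forall>y\<in>J. x * y \<in> I}"

definition ideal_prod :: "'k::comm_ring_1 set \<Rightarrow> 'k set \<Rightarrow> 'k set" where
  "ideal_prod I J = gen_submodule \<int> {x * y | x y. x \<in> I \<and> y \<in> J}"

definition trace_dual ::
  "(rat \<Rightarrow> 'k \<Rightarrow> 'k) \<Rightarrow> 'k::comm_ring_1 set \<Rightarrow> 'k set" where
  "trace_dual scl S = {x. \<forall>y\<in>S. alg_trace scl (x * y) \<in> \<int>}"

definition weakly_equivalent :: "'k::comm_ring_1 set \<Rightarrow> 'k set \<Rightarrow> bool" where
  "weakly_equivalent I J \<longleftrightarrow> 1 \<in> ideal_prod (colon I J) (colon J I)"

definition ideals_with_multiplicator_ring ::
  "(rat \<Rightarrow> 'k \<Rightarrow> 'k) \<Rightarrow> 'k::comm_ring_1 set \<Rightarrow> 'k set \<Rightarrow> 'k set set" where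
  "ideals_with_multiplicator_ring scl R S = {I. fractional_ideal scl R I \<and> colon I I = S}"

definition weak_classes ::
  "(rat \<Rightarrow> 'k \<Rightarrow> 'k) \<Rightarrow> 'k::comm_ring_1 set \<Rightarrow> 'k set \<Rightarrow> 'k set set set" where
  "weak_classes scl R S =
     (let A = ideals_with_multiplicator_ring scl R S
      in A // {(I, J). I \<in> A \<and> J \<in> A \<and> weakly_equivalent I J})"

definition list_of_representatives :: "'a list \<Rightarrow> 'a set set \<Rightarrow> bool" where
  "list_of_representatives xs \<C> \<longleftrightarrow>
     distinct xs \<and> set xs \<subseteq> \<Union>\<C> \<and> (\<forall>C\<in>\<C>. \<exists>!x. x \<in> set xs \<and> x \<in> C)"


definition additive_group_of :: "'k::comm_ring_1 set \<Rightarrow> 'k monoid" where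
  "additive_group_of T = \<lparr>carrier = T, monoid.mult = (+), one = 0\<rparr>"

definition suitable_over_order ::
  "(rat \<Rightarrow> 'k \<Rightarrow> 'k) \<Rightarrow> 'k::comm_ring_1 set \<Rightarrow> 'k set \<Rightarrow> bool" where
  "suitable_over_order scl S T \<longleftrightarrow>
     over_order scl S T \<and>
     (let U = ideal_prod (trace_dual scl S) T in 1 \<in> ideal_prod U (colon T U))"

definition quotient_subgroups :: "'k::comm_ring_1 set \<Rightarrow> 'k set \<Rightarrow> 'k set set set" where
  "quotient_subgroups S T = {H'. subgroup H' (additive_group_of T Mod colon S T)}"

text \<open>The $S$-module generated by $q^{-1}(H')$, where $q$ sends \<open>x\<close> to its coset modulo $(S:T)$.\<close>

definition candidate_ideal ::
  "'k::comm_ring_1 set \<Rightarrow> 'k set \<Rightarrow> 'k set set \<Rightarrow> 'k set" where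
  "candidate_ideal S T H' =
     gen_submodule S {x \<in> T. colon S T #>\<^bsub>additive_group_of T\<^esub> x \<in> H'}"

definition append_if_new ::
  "('k::comm_ring_1 set \<Rightarrow> bool) \<Rightarrow> 'k set list \<Rightarrow> 'k set \<Rightarrow> 'k set list" where
  "append_if_new test L I =
     (if test I \<and> \<not> (\<exists>J\<in>set L. weakly_equivalent J I) then L @ [I] else L)"

text \<open>
  \<open>algorithm_output scl test S L\<close>: on input \<open>S\<close> the algorithm may return \<open>L\<close>.
  The choice of \<open>T\<close> and the order \<open>Hs\<close> in which the subgroups are visited are left open.
  The parameter \<open>test\<close> is an additional condition on the ideals appended in the loop. With no
  condition, the loop also appends ideals whose multiplicator ring is strictly larger than \<open>S\<close>:
  for example \<open>T\<close> itself, up to weak equivalence, from $H' = Q$.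
\<close>

inductive algorithm_output ::
  "(rat \<Rightarrow> 'k \<Rightarrow> 'k) \<Rightarrow> ('k::comm_ring_1 set \<Rightarrow> bool) \<Rightarrow> 'k set \<Rightarrow> 'k set list \<Rightarrow> bool"
  for scl test S where
  trace_dual_invertible:
    "1 \<in> ideal_prod (trace_dual scl S) (colon S (trace_dual scl S)) \<Longrightarrow>
     algorithm_output scl test S [S]"
| trace_dual_not_invertible:
    "\<lbrakk> 1 \<notin> ideal_prod (trace_dual scl S) (colon S (trace_dual scl S));
       suitable_over_order scl S T;
       distinct Hs; set Hs = quotient_subgroups S T \<rbrakk> \<Longrightarrow>
     algorithm_output scl test S
       (foldl (append_if_new test) [] (map (candidate_ideal S T) Hs))"

end

theory Submission
  imports Defs
begin

text \<open>
  Let $I$ have multiplicator ring $S$. Double duality of lattices under the trace form gives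
  $S^t = I I^t$, so invertibility of $S^tT$ over $T$ forces that of $IT$. An element of $IT$ and one of
  its inverse whose product is 1 modulo $\mathfrak f = (S:T)$ yield an invertible $S$-ideal $L$ with
  $LT = (IT)^{-1}$, and then $J = LI$ is weakly equivalent to $I$ and satisfies
  $\mathfrak f \subseteq J \subseteq T$. Hence $J$ is one of the candidates of the loop, of which there are
  finitely many because $T/\mathfrak f$ is finite. A suitable $T$ is any over-order of $S$ that is maximal:
  over-orders lie between $S$ and $S^t$, so maximal ones exist, and over them every lattice is invertible.
\<close>

section \<open>Products, colons and weak equivalence\<close>

text \<open>The hypothesis on the single ideal \<open>S^t\<close> controls every \<open>I\<close>
  with multiplicator ring \<open>S\<close> because \<open>S^t T = (I T)(I^t T)\<close> and a factor
  of an invertible ideal is invertible. The obstacle is the descent from \<open>T\<close> to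
  \<open>S\<close>: an invertible \<open>T\<close>-ideal has to be the extension of an invertible
  \<open>S\<close>-ideal. Classically one glues local generators at the finitely many primes
  containing the conductor. Here the two elements with product 1 modulo the conductor come from a
  minimality argument in a finite quotient ring that mentions neither primes nor localisations; the
  same argument, run on another set of elements, yields invertibility over a maximal order. The
  conductor is the right modulus because it is an ideal of \<open>T\<close> inside \<open>S\<close>:
  it pulls every element of \<open>T\<close> that it multiplies into \<open>S\<close>. Ideals over
  the various rings are all handled as finitely generated subgroups of full rank in
  \<open>K\<close>, stable under the ring in question. Nondegeneracy of the trace form rests on
  characteristic 0: the trace of a nonzero idempotent is a positive rank.\<close>

text \<open>
  Kept as an opaque constant, so that rewriting with commutativity of multiplication does not
  disturb the module structure over the integers.
\<close>

definition int_scale :: "int \<Rightarrow> 'k::comm_ring_1 \<Rightarrow> 'k" where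
  "int_scale n x = of_int n * x"

interpretation int_module: module int_scale
  by unfold_locales (simp_all add: int_scale_def algebra_simps)

lemma submodule_over_Ints_iff: "submodule_over \<int> G \<longleftrightarrow> int_module.subspace G"
  unfolding submodule_over_def int_module.subspace_def int_scale_def by (auto elim!: Ints_cases)

lemma ideal_prod_eq_span:
  "ideal_prod I J = int_module.span {x * y | x y. x \<in> I \<and> y \<in> J}"
  unfolding ideal_prod_def gen_submodule_def int_module.span_def submodule_over_Ints_iff[abs_def] ..

lemma subspace_ideal_prod [simp, intro]: "int_module.subspace (ideal_prod I J)"
  by (simp add: ideal_prod_eq_span)

lemma ideal_prodI: "x \<in> I \<Longrightarrow> y \<in> J \<Longrightarrow> x * y \<in> ideal_prod I J"
  unfolding ideal_prod_eq_span by (rule int_module.span_base) blast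

lemma ideal_prod_minimal:
  assumes "int_module.subspace G" and "\<And>x y. x \<in> I \<Longrightarrow> y \<in> J \<Longrightarrow> x * y \<in> G"
  shows "ideal_prod I J \<subseteq> G"
  unfolding ideal_prod_eq_span using assms by (intro int_module.span_minimal) auto

lemma ideal_prod_commute: "ideal_prod I J = ideal_prod J I"
  by (intro equalityI ideal_prod_minimal subspace_ideal_prod) (metis ideal_prodI mult.commute)+

text \<open>Feeds \<open>ideal_prod_minimal\<close>: the multipliers that carry \<open>y\<close>
  into a target subgroup form a subgroup, so a claim about every element of a product, in particular
  about 1, reduces to generators. Most arguments about products below have this shape.\<close>

lemma subspace_mult_preimage:
  assumes "int_module.subspace G"
  shows "int_module.subspace {x. x * y \<in> G}"
proof (rule int_module.subspaceI)
  fix n x assume "x \<in> {x. x * y \<in> G}"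
  then show "int_scale n x \<in> {x. x * y \<in> G}"
    using int_module.subspace_scale[OF assms, of "x * y" n] by (simp add: int_scale_def mult.assoc)
qed (use assms in \<open>auto simp: distrib_right int_module.subspace_0 int_module.subspace_add\<close>)

lemma subspace_colon:
  assumes "int_module.subspace I"
  shows "int_module.subspace (colon I J)"
proof -
  have "colon I J = (\<Inter>y\<in>J. {x. x * y \<in> I})"
    by (auto simp: colon_def)
  then show ?thesis
    by (auto intro!: int_module.subspace_Int subspace_mult_preimage assms)
qed

lemma ideal_prod_mult_closed:
  assumes "x \<in> ideal_prod I J" and "\<And>y. y \<in> J \<Longrightarrow> s * y \<in> J"
  shows "s * x \<in> ideal_prod I J"
proof -
  have "ideal_prod I J \<subseteq> {x. x * s \<in> ideal_prod I J}"
  proof (intro ideal_prod_minimal subspace_mult_preimage subspace_ideal_prod)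
    fix x y assume "x \<in> I" "y \<in> J"
    then have "x * (s * y) \<in> ideal_prod I J"
      by (intro ideal_prodI assms(2))
    then show "x * y \<in> {x. x * s \<in> ideal_prod I J}" by (simp add: ac_simps)
  qed
  then show ?thesis
    using assms(1) by (auto simp: mult.commute)
qed

lemma unital_subringD:
  assumes "unital_subring T"
  shows "1 \<in> T" "int_module.subspace T" "\<And>x y. x \<in> T \<Longrightarrow> y \<in> T \<Longrightarrow> x * y \<in> T"
proof -
  show one: "1 \<in> T"
    using assms unfolding unital_subring_def by auto
  show mult: "x * y \<in> T" if "x \<in> T" "y \<in> T" for x y
    using assms that unfolding unital_subring_def by auto
  have diff: "x - y \<in> T" if "x \<in> T" "y \<in> T" for x y
    using assms that unfolding unital_subring_def by auto
  have zero: "0 \<in> T" using diff[OF one one] by simp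
  have add: "x + y \<in> T" if "x \<in> T" "y \<in> T" for x y
    using diff[OF that(1) diff[OF zero that(2)]] by simp
  have "of_nat n \<in> T" for n
    by (induction n) (auto intro: zero add one)
  then have "of_int n \<in> T" for n
    using diff[OF zero] by (cases n rule: int_cases2) auto
  then show "int_module.subspace T"
    by (intro int_module.subspaceI) (auto simp: int_scale_def intro: zero add mult)
qed

lemma unital_subring_colon_self:
  assumes "int_module.subspace I"
  shows "unital_subring (colon I I)"
  using int_module.subspace_diff[OF assms]
  by (auto simp: unital_subring_def colon_def left_diff_distrib mult.assoc)

section \<open>Weak equivalence is an equivalence relation and preserves the multiplicator
  ring\<close>

lemma weakly_equivalent_refl: "weakly_equivalent I I"
proof -
  have "1 \<in> colon I I" by (simp add: colon_def)
  from ideal_prodI[OF this this] show ?thesis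
    by (simp add: weakly_equivalent_def)
qed

lemma weakly_equivalent_sym: "weakly_equivalent I J \<Longrightarrow> weakly_equivalent J I"
  by (simp add: weakly_equivalent_def ideal_prod_commute)

text \<open>Multiply the two expressions of 1: \<open>(I:J)(J:K)\<close> lies in
  \<open>(I:K)\<close> and \<open>(K:J)(J:I)\<close> in \<open>(K:I)\<close>, so
  \<open>a * b * (c * d)\<close> regroups as \<open>(a * c) * (d * b)\<close>. Bilinearity is used
  one factor at a time.\<close>

lemma weakly_equivalent_trans:
  assumes "weakly_equivalent I J" and "weakly_equivalent J K"
  shows "weakly_equivalent I K"
proof -
  let ?W = "ideal_prod (colon I K) (colon K I)"
  have *: "a * b * (c * d) \<in> ?W"
    if "a \<in> colon I J" "b \<in> colon J I" "c \<in> colon J K" "d \<in> colon K J" for a b c d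
  proof -
    have "(a * c) * (d * b) \<in> ?W"
      using that by (intro ideal_prodI) (auto simp: colon_def mult.assoc)
    then show ?thesis by (simp add: ac_simps)
  qed
  have "ideal_prod (colon J K) (colon K J) \<subseteq> {u. u * v \<in> ?W}"
    if "v \<in> ideal_prod (colon I J) (colon J I)" for v
  proof (rule ideal_prod_minimal)
    fix c d assume cd: "c \<in> colon J K" "d \<in> colon K J"
    have "ideal_prod (colon I J) (colon J I) \<subseteq> {v. v * (c * d) \<in> ?W}"
      using cd by (intro ideal_prod_minimal subspace_mult_preimage) (auto intro: *)
    with that show "c * d \<in> {u. u * v \<in> ?W}" by (auto simp: mult.commute)
  qed (intro subspace_mult_preimage subspace_ideal_prod)
  from this[of 1] assms show ?thesis
    unfolding weakly_equivalent_def by auto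
qed

text \<open>For \<open>a\<close> in \<open>(I:J)\<close> and \<open>b\<close> in
  \<open>(J:I)\<close>, multiplication by \<open>a\<close> sends \<open>J\<close> into
  \<open>I\<close>, \<open>x\<close> keeps it there, and \<open>b\<close> returns to
  \<open>J\<close>. Hence \<open>a * b * x\<close> preserves \<open>J\<close>, and summing the
  \<open>a * b\<close> to 1 leaves \<open>x\<close>.\<close>

lemma weakly_equivalent_colon_self_subset:
  assumes "weakly_equivalent I J" and "int_module.subspace J"
  shows "colon I I \<subseteq> colon J J"
proof
  fix x assume x: "x \<in> colon I I"
  have "ideal_prod (colon I J) (colon J I) \<subseteq> {u. u * x \<in> colon J J}"
  proof (intro ideal_prod_minimal subspace_mult_preimage subspace_colon assms(2))
    fix a b assume "a \<in> colon I J" "b \<in> colon J I"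
    then have "b * (x * (a * y)) \<in> J" if "y \<in> J" for y
      using x that by (simp add: colon_def)
    then show "a * b \<in> {u. u * x \<in> colon J J}"
      by (simp add: colon_def ac_simps)
  qed
  then show "x \<in> colon J J"
    using assms(1) by (auto simp: weakly_equivalent_def)
qed

lemma weakly_equivalent_colon_self_eq:
  assumes "weakly_equivalent I J" "int_module.subspace I" "int_module.subspace J"
  shows "colon I I = colon J J"
  using assms weakly_equivalent_sym weakly_equivalent_colon_self_subset by blast

section \<open>Finite quotients\<close>

text \<open>Finiteness of \<open>T/F\<close> through a finite set of coset representatives, without
  forming a quotient. Neither \<open>F\<close> nor \<open>Q\<close> is tied to \<open>T\<close>,
  which makes the notion monotone in both arguments.\<close>

definition finite_index :: "'k::comm_ring_1 set \<Rightarrow> 'k set \<Rightarrow> bool" where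
  "finite_index F T \<longleftrightarrow> (\<exists>Q. finite Q \<and> (\<forall>x\<in>T. \<exists>q\<in>Q. x - q \<in> F))"

lemma finite_index_mono:
  "finite_index F T \<Longrightarrow> F \<subseteq> F' \<Longrightarrow> T' \<subseteq> T \<Longrightarrow> finite_index F' T'"
  unfolding finite_index_def by (meson subsetD)

text \<open>A subgroup containing \<open>F\<close> is a union of cosets, hence within
  \<open>T\<close> it is determined by the representatives it contains.\<close>

lemma finite_subgroups_between:
  assumes "finite_index F T"
  shows "finite {G. int_module.subspace G \<and> F \<subseteq> G \<and> G \<subseteq> T}"
proof -
  obtain Q where Q: "finite Q" "\<And>x. x \<in> T \<Longrightarrow> \<exists>q\<in>Q. x - q \<in> F"
    using assms by (auto simp: finite_index_def)
  have "G \<in> (\<lambda>A. {x\<in>T. \<exists>q\<in>A. x - q \<in> F}) ` Pow Q"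
    if G: "int_module.subspace G" "F \<subseteq> G" "G \<subseteq> T" for G
  proof (rule image_eqI[where x = "Q \<inter> G"])
    show "G = {x\<in>T. \<exists>q\<in>Q \<inter> G. x - q \<in> F}"
    proof (intro equalityI subsetI)
      fix x assume x: "x \<in> G"
      with Q G obtain q where q: "q \<in> Q" "x - q \<in> F" by blast
      have "x - (x - q) \<in> G"
        using int_module.subspace_diff[OF G(1) x, of "x - q"] q G by blast
      then have "q \<in> G" by simp
      with x q G show "x \<in> {x\<in>T. \<exists>q\<in>Q \<inter> G. x - q \<in> F}" by auto
    next
      fix x assume "x \<in> {x\<in>T. \<exists>q\<in>Q \<inter> G. x - q \<in> F}"
      then obtain q where "q \<in> G" "x - q \<in> G" using G by auto
      from int_module.subspace_add[OF G(1) this] show "x \<in> G" by simp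
    qed
  qed auto
  then have "{G. int_module.subspace G \<and> F \<subseteq> G \<and> G \<subseteq> T} \<subseteq> (\<lambda>A. {x\<in>T. \<exists>q\<in>A. x - q \<in> F}) ` Pow Q"
    by auto
  then show ?thesis
    using Q(1) by (meson finite_Pow_iff finite_imageI finite_subset)
qed

text \<open>
  A substitute for localisation at the maximal ideals of $T/F$. Choose \<open>c\<close> with the ideal
  $cT + F$ minimal; if it were larger than \<open>F\<close>, it would contain a \<open>y\<close> generating a minimal
  nonzero ideal of $T/F$. Replacing \<open>c\<close> by a multiple \<open>c * d\<close> with \<open>y * d \<in> F\<close> would make
  $cT + F$ strictly smaller.
\<close>

lemma finite_quotient_descent:
  fixes T F C :: "'k::comm_ring_1 set"
  assumes T: "unital_subring T"
    and F: "int_module.subspace F" "F \<subseteq> T" "\<And>t x. t \<in> T \<Longrightarrow> x \<in> F \<Longrightarrow> x * t \<in> F"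
    and index: "finite_index F T"
    and C: "C \<subseteq> T" "C \<noteq> {}"
    and step: "\<And>c y. \<lbrakk>c \<in> C; y \<in> T; y \<notin> F; \<exists>s\<in>T. y = c * s;
        \<And>z. z \<in> T \<Longrightarrow> y * z \<notin> F \<Longrightarrow> \<exists>t\<in>T. y - y * z * t \<in> F\<rbrakk>
      \<Longrightarrow> \<exists>d\<in>T. c * d \<in> C \<and> y * d \<in> F"
  shows "\<exists>c\<in>C. c \<in> F"
proof -
  note T' = unital_subringD[OF T]
  define PI where "PI x = {x * t + f | t f. t \<in> T \<and> f \<in> F}" for x
  have "int_module.subspace (PI x)" for x
  proof (rule int_module.subspaceI)
    show "0 \<in> PI x"
      unfolding PI_def using int_module.subspace_0[OF T'(2)] int_module.subspace_0[OF F(1)]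
      by force
  next
    fix u v assume "u \<in> PI x" "v \<in> PI x"
    then obtain t f t' f' where uv: "u = x * t + f" "v = x * t' + f'"
      and tf: "t \<in> T" "f \<in> F" "t' \<in> T" "f' \<in> F"
      unfolding PI_def by auto
    have "u + v = x * (t + t') + (f + f')"
      unfolding uv by (simp add: algebra_simps)
    with tf show "u + v \<in> PI x"
      unfolding PI_def using int_module.subspace_add T'(2) F(1) by blast
  next
    fix n u assume "u \<in> PI x"
    then obtain t f where u: "u = x * t + f" and tf: "t \<in> T" "f \<in> F"
      unfolding PI_def by auto
    have "int_scale n u = x * int_scale n t + int_scale n f"
      unfolding u by (simp add: int_scale_def algebra_simps)
    with tf show "int_scale n u \<in> PI x"
      unfolding PI_def using int_module.subspace_scale T'(2) F(1) by blast
  qed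
  moreover have "F \<subseteq> PI x" for x
    unfolding PI_def using int_module.subspace_0[OF T'(2)] by force
  moreover have "PI x \<subseteq> T" if "x \<in> T" for x
    unfolding PI_def using that T'(3) F(2) int_module.subspace_add[OF T'(2)] by blast
  ultimately have "PI ` T \<subseteq> {G. int_module.subspace G \<and> F \<subseteq> G \<and> G \<subseteq> T}"
    by blast
  then have fin: "finite (PI ` T)"
    using finite_subgroups_between[OF index] finite_subset by blast
  have minimal: "\<exists>a\<in>A. \<forall>b\<in>A. PI b \<subseteq> PI a \<longrightarrow> PI a = PI b" if "A \<subseteq> T" "A \<noteq> {}" for A
  proof -
    have "finite (PI ` A)" using fin that(1) by (meson finite_subset image_mono)
    from finite_has_minimal[OF this] that(2) show ?thesis by auto
  qed
  have PI_mult: "PI (a * z) \<subseteq> PI a" if "z \<in> T" for a z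
    unfolding PI_def using that T'(3) by (force simp: mult.assoc)
  have self: "a \<in> PI a" for a
    unfolding PI_def using T'(1) int_module.subspace_0[OF F(1)] by force
  obtain c where c: "c \<in> C" and min_c: "\<And>b. b \<in> C \<Longrightarrow> PI b \<subseteq> PI c \<Longrightarrow> PI c = PI b"
    using minimal[OF C] by blast
  have "c \<in> F"
  proof (rule ccontr)
    assume "c \<notin> F"
    define A where "A = {c * s | s. s \<in> T} - F"
    have "c \<in> A" unfolding A_def using \<open>c \<notin> F\<close> T'(1) by force
    moreover have "A \<subseteq> T" unfolding A_def using c C T'(3) by auto
    ultimately obtain y where y: "y \<in> A" and min_y: "\<And>b. b \<in> A \<Longrightarrow> PI b \<subseteq> PI y \<Longrightarrow> PI y = PI b"
      using minimal[of A] by blast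
    obtain s where s: "s \<in> T" "y = c * s" and "y \<notin> F" using y by (auto simp: A_def)
    have "y \<in> T" using y \<open>A \<subseteq> T\<close> by auto
    \<comment> \<open>Minimality of \<open>y T + F\<close> in the form handed to
      \<open>step\<close>: a multiple of \<open>y\<close> outside \<open>F\<close> generates
      \<open>y\<close> back modulo \<open>F\<close>.\<close>
    have "\<exists>t\<in>T. y - y * z * t \<in> F" if z: "z \<in> T" "y * z \<notin> F" for z
    proof -
      have "y * z \<in> A" unfolding A_def using z s T'(3) by (auto simp: mult.assoc)
      then have "y \<in> PI (y * z)" using min_y PI_mult[OF z(1)] self by blast
      then obtain t f where t: "t \<in> T" "f \<in> F" and y_eq: "y = y * z * t + f"
        unfolding PI_def by blast
      from y_eq have "y - y * z * t = f" by (metis add_diff_cancel_left')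
      with t show ?thesis by auto
    qed
    with c s \<open>y \<in> T\<close> \<open>y \<notin> F\<close> obtain d where d: "d \<in> T" "c * d \<in> C" "y * d \<in> F"
      using step[of c y] by blast
    \<comment> \<open>Minimality of \<open>c\<close> makes \<open>c\<close> a multiple of
      \<open>c * d\<close> modulo \<open>F\<close>. Multiplied by \<open>s\<close>, this makes
      \<open>y\<close> a multiple of \<open>y * d\<close> modulo \<open>F\<close>, and
      \<open>y * d\<close> lies in \<open>F\<close>.\<close>
    have "c \<in> PI (c * d)" using min_c[OF d(2)] PI_mult[OF d(1)] self by blast
    then obtain t f where t: "t \<in> T" "f \<in> F" and c_eq: "c = c * d * t + f"
      unfolding PI_def by blast
    have "y = (c * d * t + f) * s" using s c_eq by simp
    also have "\<dots> = (y * d) * t + f * s" by (simp add: s algebra_simps)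
    also have "\<dots> \<in> F"
      using F t d s by (intro int_module.subspace_add) auto
    finally show False using \<open>y \<notin> F\<close> by simp
  qed
  with c show ?thesis by blast
qed

text \<open>An invertible ideal is locally principal, and local generators could be glued by the
  Chinese remainder theorem. Instead the descent runs over all \<open>1 - p * q\<close>: changing
  \<open>a\<close> and \<open>b\<close> by multiples of \<open>c = 1 - a * b\<close> multiplies
  \<open>c\<close> by a factor \<open>d\<close>, and the change is chosen so that \<open>d\<close>
  annihilates \<open>y\<close> modulo \<open>F\<close>.\<close>

lemma invertible_ideal_unit_mod:
  fixes T F P P' :: "'k::comm_ring_1 set"
  assumes T: "unital_subring T"
    and F: "int_module.subspace F" "F \<subseteq> T" "\<And>t x. t \<in> T \<Longrightarrow> x \<in> F \<Longrightarrow> x * t \<in> F"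
    and index: "finite_index F T"
    and P: "int_module.subspace P" "\<And>t p. t \<in> T \<Longrightarrow> p \<in> P \<Longrightarrow> t * p \<in> P"
    and P': "int_module.subspace P'" "\<And>t p. t \<in> T \<Longrightarrow> p \<in> P' \<Longrightarrow> t * p \<in> P'"
    and PP': "\<And>p q. p \<in> P \<Longrightarrow> q \<in> P' \<Longrightarrow> p * q \<in> T" "1 \<in> ideal_prod P P'"
  shows "\<exists>p\<in>P. \<exists>q\<in>P'. 1 - p * q \<in> F"
proof -
  note T' = unital_subringD[OF T]
  define C where "C = {1 - p * q | p q. p \<in> P \<and> q \<in> P'}"
  have "\<exists>c\<in>C. c \<in> F"
  proof (rule finite_quotient_descent[OF T F index])
    show "C \<subseteq> T" unfolding C_def using T' PP' int_module.subspace_diff by blast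
    show "C \<noteq> {}" unfolding C_def using int_module.subspace_0 P(1) P'(1) by blast
  next
    fix c y assume "c \<in> C" and y: "y \<in> T" "y \<notin> F"
      and min: "\<And>z. z \<in> T \<Longrightarrow> y * z \<notin> F \<Longrightarrow> \<exists>t\<in>T. y - y * z * t \<in> F"
    then obtain a b where ab: "a \<in> P" "b \<in> P'" and c: "c = 1 - a * b"
      unfolding C_def by blast
    have cT: "c \<in> T" unfolding c using ab T' PP' int_module.subspace_diff by blast
    show "\<exists>d\<in>T. c * d \<in> C \<and> y * d \<in> F"
    \<comment> \<open>The elements of \<open>T\<close> annihilating \<open>y\<close> modulo
      \<open>F\<close> form a maximal ideal; the question is whether \<open>a\<close> already
      generates \<open>P\<close> locally there. If so, only \<open>b\<close> changes, to
      \<open>b + c * (t * q)\<close>, where \<open>t\<close> normalises \<open>a * q\<close> to act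
      as 1 on \<open>y\<close> modulo \<open>F\<close>.\<close>
    proof (cases "\<exists>q\<in>P'. y * (a * q) \<notin> F")
      case True
      then obtain q where q: "q \<in> P'" "y * (a * q) \<notin> F" by blast
      with min[of "a * q"] ab PP' obtain t where t: "t \<in> T" "y - y * (a * q) * t \<in> F" by blast
      let ?d = "1 - a * (t * q)"
      have tq: "t * q \<in> P'" using P' t q by blast
      have "c * ?d = 1 - a * (b + c * (t * q))"
        unfolding c by (simp add: algebra_simps)
      moreover have "b + c * (t * q) \<in> P'"
        using tq ab cT P' by (intro int_module.subspace_add) auto
      ultimately have "c * ?d \<in> C" unfolding C_def using ab by blast
      moreover have "y * ?d \<in> F" using t(2) by (simp add: algebra_simps)
      moreover have "?d \<in> T" using T' PP' ab tq by (intro int_module.subspace_diff) auto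
      ultimately show ?thesis by blast
    next
      case no_q: False
      show ?thesis
      proof (cases "\<exists>p\<in>P. y * (p * b) \<notin> F")
        case True
        then obtain p where p: "p \<in> P" "y * (p * b) \<notin> F" by blast
        with min[of "p * b"] ab PP' obtain t where t: "t \<in> T" "y - y * (p * b) * t \<in> F" by blast
        let ?d = "1 - (t * p) * b"
        have tp: "t * p \<in> P" using P t p by blast
        have "c * ?d = 1 - (a + c * (t * p)) * b"
          unfolding c by (simp add: algebra_simps)
        moreover have "a + c * (t * p) \<in> P"
          using tp ab cT P by (intro int_module.subspace_add) auto
        ultimately have "c * ?d \<in> C" unfolding C_def using ab by blast
        moreover have "y * ?d \<in> F" using t(2) by (simp add: algebra_simps)
        moreover have "?d \<in> T" using T' PP' ab tp by (intro int_module.subspace_diff) auto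
        ultimately show ?thesis by blast
      next
        \<comment> \<open>Neither \<open>a\<close> nor \<open>b\<close> is a local generator here,
          so both are corrected at once, to \<open>a + c * p\<close> and \<open>b + c * r\<close>.
          The terms \<open>a * r\<close>, \<open>p * b\<close> and \<open>a * b\<close> all
          annihilate \<open>y\<close> modulo \<open>F\<close>, which leaves only
          \<open>p * r\<close>, normalised to act as 1 on \<open>y\<close>.\<close>
        case no_p: False
        have "\<exists>p\<in>P. \<exists>q\<in>P'. y * (p * q) \<notin> F"
        proof (rule ccontr)
          assume "\<not> ?thesis"
          then have "ideal_prod P P' \<subseteq> {x. x * y \<in> F}"
            by (intro ideal_prod_minimal subspace_mult_preimage F) (auto simp: mult.commute)
          with PP' y show False by auto
        qed
        then obtain p q where pq: "p \<in> P" "q \<in> P'" "y * (p * q) \<notin> F" by blast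
        with min[of "p * q"] PP' obtain t where t: "t \<in> T" "y - y * (p * q) * t \<in> F" by blast
        define r where "r = t * q"
        have r: "r \<in> P'" unfolding r_def using t P' pq by blast
        have yr: "y - y * (p * r) \<in> F" using t(2) by (simp add: r_def ac_simps)
        let ?d = "1 - a * r - p * b - c * (p * r)"
        have "c * ?d = 1 - (a + c * p) * (b + c * r)"
          unfolding c by (simp add: algebra_simps)
        moreover have "a + c * p \<in> P"
          using pq ab cT P by (intro int_module.subspace_add) auto
        moreover have "b + c * r \<in> P'"
          using r ab cT P' by (intro int_module.subspace_add) auto
        ultimately have "c * ?d \<in> C" unfolding C_def by blast
        moreover have "y * ?d \<in> F"
        proof -
          have "y * (a * r) \<in> F" "y * (p * b) \<in> F" "y * (a * b) \<in> F"
            using no_q no_p r ab pq by auto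
          moreover have "p * r \<in> T" using PP' pq r by blast
          ultimately have "(y - y * (p * r)) - y * (a * r) - y * (p * b) + y * (a * b) * (p * r) \<in> F"
            using yr F(3) by (blast intro: int_module.subspace_add[OF F(1)] int_module.subspace_diff[OF F(1)])
          then show ?thesis unfolding c by (simp add: algebra_simps)
        qed
        moreover have "?d \<in> T"
          using T' PP' ab r pq cT by (intro int_module.subspace_diff) auto
        ultimately show ?thesis by blast
      qed
    qed
  qed
  then show ?thesis unfolding C_def by blast
qed

section \<open>The conductor, and the descent of invertible ideals from \<open>T\<close> to
  \<open>S\<close>\<close>

lemma colon_subring:
  assumes S: "unital_subring S" and T: "unital_subring T"
  shows "int_module.subspace (colon S T)" "colon S T \<subseteq> S"
    "\<And>t x. t \<in> T \<Longrightarrow> x \<in> colon S T \<Longrightarrow> x * t \<in> colon S T"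
proof -
  show "int_module.subspace (colon S T)"
    using unital_subringD(2)[OF S] by (rule subspace_colon)
  show "colon S T \<subseteq> S"
    using unital_subringD(1)[OF T] by (force simp: colon_def)
  show "x * t \<in> colon S T" if "t \<in> T" "x \<in> colon S T" for t x
    using that unital_subringD(3)[OF T] by (auto simp: colon_def mult.assoc)
qed

text \<open>
  With $P = IT$, $P' = (T:P)$ and $\mathfrak f = (S:T)$, choose $a \in P$, $b \in P'$ with
  $1 - ab \in \mathfrak f$. Then $aS + \mathfrak f P$ and $bS + \mathfrak f P'$ are mutually inverse
  \<open>S\<close>-ideals, and $J = (bS + \mathfrak f P') I$. The sets \<open>L\<close> and \<open>L'\<close> below generate
  these two ideals over \<open>S\<close>.
\<close>

lemma weakly_equivalent_between:
  fixes S T I :: "'k::comm_ring_1 set"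
  assumes S: "unital_subring S" and T: "unital_subring T" and "S \<subseteq> T"
    and index: "finite_index (colon S T) T"
    and I: "\<And>s x. s \<in> S \<Longrightarrow> x \<in> I \<Longrightarrow> s * x \<in> I"
    and Isub: "int_module.subspace I"
    and inv: "1 \<in> ideal_prod (ideal_prod I T) (colon T (ideal_prod I T))"
  obtains J where "int_module.subspace J" "\<And>s x. s \<in> S \<Longrightarrow> x \<in> J \<Longrightarrow> s * x \<in> J"
    "colon S T \<subseteq> J" "J \<subseteq> T" "weakly_equivalent J I"
proof -
  note S' = unital_subringD[OF S] and T' = unital_subringD[OF T]
  note F = colon_subring[OF S T]
  let ?F = "colon S T"
  define P where "P = ideal_prod I T"
  define P' where "P' = colon T P"
  have P: "int_module.subspace P" "\<And>t p. t \<in> T \<Longrightarrow> p \<in> P \<Longrightarrow> t * p \<in> P"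
    unfolding P_def using T' by (auto intro: ideal_prod_mult_closed)
  have P': "int_module.subspace P'" "\<And>t p. t \<in> T \<Longrightarrow> p \<in> P' \<Longrightarrow> t * p \<in> P'"
    unfolding P'_def using T' by (blast intro: subspace_colon) (auto simp: colon_def mult.assoc T'(3))
  have PP': "\<And>p q. p \<in> P \<Longrightarrow> q \<in> P' \<Longrightarrow> p * q \<in> T" "1 \<in> ideal_prod P P'"
    using inv unfolding P'_def P_def by (auto simp: colon_def) (metis mult.commute)
  have "I \<subseteq> P"
    unfolding P_def using ideal_prodI[of _ I 1 T] T' by auto
  have "?F \<subseteq> T" using F \<open>S \<subseteq> T\<close> by auto
  from invertible_ideal_unit_mod[OF T F(1) this F(3) index P P' PP']
  obtain a b where ab: "a \<in> P" "b \<in> P'" "1 - a * b \<in> ?F" by blast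
  define c where "c = 1 - a * b"
  define L where "L = insert a {f * p | f p. f \<in> ?F \<and> p \<in> P}"
  define L' where "L' = insert b {f * q | f q. f \<in> ?F \<and> q \<in> P'}"
  \<comment> \<open>The products land in \<open>S\<close> and not merely in \<open>T\<close>:
    \<open>a * b = 1 - c\<close> with \<open>c\<close> in the conductor, and every other product has
    a conductor factor, which absorbs elements of \<open>T\<close>.\<close>
  have LS: "l * l' \<in> S" if "l \<in> L" "l' \<in> L'" for l l'
  proof -
    have 1: "a * b \<in> S"
      using int_module.subspace_diff[OF S'(2) S'(1), of c] ab F by (auto simp: c_def)
    have 2: "f * (p * q) \<in> S" if "f \<in> ?F" "p \<in> P" "q \<in> P'" for f p q
      using F(2,3) that PP' by blast
    have 3: "a * (f * q) \<in> S" if "f \<in> ?F" "q \<in> P'" for f q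
      using 2[OF that(1) ab(1) that(2)] by (simp add: ac_simps)
    have 4: "f * p * b \<in> S" if "f \<in> ?F" "p \<in> P" for f p
      using 2[OF that ab(2)] by (simp add: ac_simps)
    have 5: "f * p * (f' * q) \<in> S" if "f \<in> ?F" "f' \<in> ?F" "p \<in> P" "q \<in> P'" for f f' p q
      using S'(3)[OF _ 2[OF that(2-4)], of f] that(1) F(2) by (auto simp: ac_simps)
    show ?thesis
      using that 1 3 4 5 unfolding L_def L'_def by auto
  qed
  define J where "J = ideal_prod L' I"
  show thesis
  proof
    show "int_module.subspace J" unfolding J_def by blast
    show "s * x \<in> J" if "s \<in> S" "x \<in> J" for s x
      using that I unfolding J_def by (blast intro: ideal_prod_mult_closed)
    have "L' \<subseteq> P'" using ab P' \<open>?F \<subseteq> T\<close> unfolding L'_def by auto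
    then show "J \<subseteq> T"
      unfolding J_def using PP'(1) \<open>I \<subseteq> P\<close>
      by (intro ideal_prod_minimal T'(2)) (metis mult.commute subsetD)
    show "?F \<subseteq> J"
    proof
      fix f assume f: "f \<in> ?F"
      \<comment> \<open>Write 1 as a sum of \<open>p * q\<close> and each \<open>p\<close> as a sum
        of \<open>i * t\<close>. Then \<open>f * i * t * q\<close> is \<open>f * t * q\<close>, an
        element of \<open>L'\<close> because \<open>f * t\<close> is still in the conductor, times
        \<open>i\<close> in \<open>I\<close>.\<close>
      have "ideal_prod P P' \<subseteq> {x. x * f \<in> J}"
      proof (rule ideal_prod_minimal)
        fix p q assume p: "p \<in> P" and q: "q \<in> P'"
        have "ideal_prod I T \<subseteq> {p. p * (q * f) \<in> J}"
        proof (rule ideal_prod_minimal)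
          fix i t assume it: "i \<in> I" "t \<in> T"
          have "f * t * q \<in> L'" unfolding L'_def using f it F(3) q by blast
          then have "f * t * q * i \<in> J" unfolding J_def using it by (blast intro: ideal_prodI)
          then show "i * t \<in> {p. p * (q * f) \<in> J}" by (simp add: ac_simps)
        qed (auto simp: J_def intro: subspace_mult_preimage)
        with p show "p * q \<in> {x. x * f \<in> J}" by (auto simp: P_def mult.assoc)
      qed (auto simp: J_def intro: subspace_mult_preimage)
      with PP' show "f \<in> J" by auto
    qed
    let ?W = "ideal_prod (colon J I) (colon I J)"
    \<comment> \<open>Multiplication by \<open>l'\<close> sends \<open>I\<close> into
      \<open>J\<close> by construction; \<open>l * s\<close> sends \<open>J\<close> back into
      \<open>I\<close> because products of \<open>L\<close> and \<open>L'\<close> lie in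
      \<open>S\<close> and \<open>I\<close> is stable under \<open>S\<close>.\<close>
    have *: "l' * (l * s) \<in> ?W" if "l \<in> L" "l' \<in> L'" "s \<in> S" for l l' s
    proof (rule ideal_prodI)
      show "l' \<in> colon J I"
        unfolding J_def colon_def using that by (auto intro: ideal_prodI)
      have "J \<subseteq> {x. x * (l * s) \<in> I}"
        unfolding J_def
      proof (intro ideal_prod_minimal subspace_mult_preimage Isub CollectI)
        fix x i assume "x \<in> L'" "i \<in> I"
        with I[OF S'(3)[OF LS[OF that(1)] that(3)], of x i]
        show "x * i * (l * s) \<in> I" by (simp add: ac_simps)
      qed
      then show "l * s \<in> colon I J" by (auto simp: colon_def mult.commute)
    qed
    \<comment> \<open>With \<open>a * b = 1 - c\<close>, the identity is
      \<open>1 = a * b * (1 + c) + c * c\<close>. The square is essential: one factor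
      \<open>c\<close> goes with \<open>P\<close> into \<open>L\<close> and the other with
      \<open>P'\<close> into \<open>L'\<close>, which a single \<open>c\<close> would not
      allow.\<close>
    have "b * (a * (1 + c)) \<in> ?W"
    proof (rule *)
      show "1 + c \<in> S"
        using int_module.subspace_add[OF S'(2) S'(1), of c] F(2) ab by (auto simp: c_def)
    qed (auto simp: L_def L'_def)
    moreover have "c * c \<in> ?W"
    proof -
      have "ideal_prod P P' \<subseteq> {x. x * (c * c) \<in> ?W}"
      proof (rule ideal_prod_minimal)
        fix p q assume "p \<in> P" "q \<in> P'"
        then have "c * q * (c * p * 1) \<in> ?W"
          using S' ab by (intro *) (auto simp: L_def L'_def c_def)
        then show "p * q \<in> {x. x * (c * c) \<in> ?W}" by (simp add: ac_simps)
      qed (auto intro: subspace_mult_preimage)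
      with PP' show ?thesis by auto
    qed
    ultimately have "b * (a * (1 + c)) + c * c \<in> ?W"
      by (auto intro: int_module.subspace_add)
    also have "b * (a * (1 + c)) + c * c = 1" by (simp add: c_def algebra_simps)
    finally show "weakly_equivalent J I" by (simp add: weakly_equivalent_def)
  qed
qed

section \<open>Denominators and integral spans\<close>

lemma common_denominator:
  fixes u :: "'a \<Rightarrow> rat"
  assumes "finite A"
  shows "\<exists>N::int. N > 0 \<and> (\<forall>x\<in>A. of_int N * u x \<in> \<int>)"
  using assms
proof (induction A)
  case empty
  show ?case by (rule exI[of _ 1]) simp
next
  case (insert a A)
  then obtain N where N: "N > 0" "\<forall>x\<in>A. of_int N * u x \<in> \<int>" by blast
  obtain p q where pq: "quotient_of (u a) = (p, q)" by (cases "quotient_of (u a)")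
  then have q: "q > 0" and u: "u a = of_int p / of_int q"
    by (auto simp: quotient_of_denom_pos quotient_of_div)
  have "of_int (q * N) * u x \<in> \<int>" if "x \<in> insert a A" for x
  proof (cases "x = a")
    case True
    then have "of_int (q * N) * u x = of_int (N * p)" using q u by simp
    then show ?thesis by (metis Ints_of_int)
  next
    case False
    with that N have "of_int N * u x \<in> \<int>" by blast
    then have "of_int q * (of_int N * u x) \<in> \<int>" by (rule Ints_mult[OF Ints_of_int])
    then show ?thesis by (simp add: mult.assoc)
  qed
  then show ?case using N q by (intro exI[of _ "q * N"]) auto
qed

lemma ideal_prod_span:
  "ideal_prod (int_module.span X) (int_module.span Y) = int_module.span {x * y | x y. x \<in> X \<and> y \<in> Y}"
  (is "_ = ?W")
proof
  show "?W \<subseteq> ideal_prod (int_module.span X) (int_module.span Y)"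
    by (intro int_module.span_minimal subspace_ideal_prod)
      (auto intro: ideal_prodI int_module.span_base)
  show "ideal_prod (int_module.span X) (int_module.span Y) \<subseteq> ?W"
  proof (rule ideal_prod_minimal)
    fix x y assume x: "x \<in> int_module.span X" and y: "y \<in> int_module.span Y"
    have 1: "int_module.span Y \<subseteq> {y. y * x \<in> ?W}" if "x \<in> X" for x
    proof (intro int_module.span_minimal subspace_mult_preimage int_module.subspace_span subsetI CollectI)
      fix y assume "y \<in> Y"
      with that have "x * y \<in> ?W" by (intro int_module.span_base) blast
      then show "y * x \<in> ?W" by (simp add: mult.commute)
    qed
    have "x * y \<in> ?W" if "x \<in> X" for x
      using 1[OF that] y by (auto simp: mult.commute)
    then have "int_module.span X \<subseteq> {x. x * y \<in> ?W}"
      by (intro int_module.span_minimal subspace_mult_preimage int_module.subspace_span) auto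
    with x show "x * y \<in> ?W" by auto
  qed simp
qed

text \<open>The coefficient of each added generator matters only modulo \<open>N\<close>, so every
  generator multiplies the set of representatives by the residues \<open>0..<N\<close>. Any finite
  generating set serves, whether or not it is a basis.\<close>

lemma finite_index_int_scale:
  assumes "finite X" and N: "N > 0"
  shows "finite_index (int_scale N ` int_module.span X) (int_module.span X)"
  using assms(1)
proof (induction X)
  case empty
  show ?case unfolding finite_index_def by (rule exI[of _ "{0}"]) auto
next
  case (insert a X)
  then obtain Q where Q: "finite Q"
    "\<And>x. x \<in> int_module.span X \<Longrightarrow> \<exists>q\<in>Q. x - q \<in> int_scale N ` int_module.span X"
    unfolding finite_index_def by blast
  let ?Q = "(\<lambda>(q, k). q + int_scale k a) ` (Q \<times> {0..<N})"
  have "\<exists>q\<in>?Q. x - q \<in> int_scale N ` int_module.span (insert a X)"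
    if x: "x \<in> int_module.span (insert a X)" for x
  proof -
    obtain k where k: "x - int_scale k a \<in> int_module.span X"
      using x int_module.span_breakdown_eq by blast
    then obtain q z where q: "q \<in> Q" and z: "z \<in> int_module.span X"
      and eq: "x - int_scale k a - q = int_scale N z"
      using Q(2) by blast
    have "x - (q + int_scale (k mod N) a) = (x - int_scale k a - q) + int_scale (k - k mod N) a"
      by (simp add: int_scale_def algebra_simps)
    also have "k - k mod N = N * (k div N)" by (simp add: minus_mod_eq_mult_div)
    also have "(x - int_scale k a - q) + int_scale (N * (k div N)) a
        = int_scale N (z + int_scale (k div N) a)"
      unfolding eq by (simp add: int_scale_def algebra_simps)
    finally have "x - (q + int_scale (k mod N) a) = int_scale N (z + int_scale (k div N) a)" .
    moreover have "z + int_scale (k div N) a \<in> int_module.span (insert a X)"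
      using z int_module.span_mono[of X "insert a X"]
      by (intro int_module.span_add int_module.span_scale) (auto intro: int_module.span_base)
    moreover have "q + int_scale (k mod N) a \<in> ?Q"
      using q N by (intro image_eqI[where x = "(q, k mod N)"]) auto
    ultimately show ?thesis by blast
  qed
  moreover have "finite ?Q" using Q(1) by blast
  ultimately show ?case unfolding finite_index_def by blast
qed

context etale_algebra
begin

section \<open>The trace form\<close>

lemma scl_of_int: "scl (of_int n) x = int_scale n x"
proof -
  have nat: "scl (of_nat n) x = of_nat n * x" for n
    by (induction n) (simp_all add: scale_left_distrib distrib_right)
  have neg: "scl (- of_nat n) x = - (of_nat n * x)" for n
    using nat[of n] by (simp add: scale_minus_left)
  show ?thesis
    unfolding int_scale_def using nat neg by (cases n rule: int_cases2) auto
qed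

lemma int_scale_eq_0_iff: "int_scale n (x::'k) = 0 \<longleftrightarrow> n = 0 \<or> x = 0"
  using scale_eq_0_iff[of "of_int n" x] by (simp add: scl_of_int)

lemma mult_scl: "x * scl a y = scl a (x * y)"
  using scl_mult[of a y x] by (simp add: mult.commute)

lemma sum_mult_scl: "x * (\<Sum>i\<in>I. scl (a i) (y i)) = (\<Sum>i\<in>I. scl (a i) (x * y i))"
  by (simp add: sum_distrib_left mult_scl)

lemma finite_spanning_set: "\<exists>A. finite A \<and> span A = UNIV"
proof -
  obtain E where E: "finite E" "\<forall>e\<in>E. field_factor scl e" "(\<Sum>e\<in>E. e) = 1"
    using product_of_number_fields by blast
  then have "\<forall>e\<in>E. \<exists>B. finite B \<and> span B = range (\<lambda>x. e * x)"
    unfolding field_factor_def by blast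
  then obtain B where B: "\<And>e. e \<in> E \<Longrightarrow> finite (B e)" "\<And>e. e \<in> E \<Longrightarrow> span (B e) = range (\<lambda>x. e * x)"
    by metis
  have "x \<in> span (\<Union>e\<in>E. B e)" for x
  proof -
    have "e * x \<in> span (\<Union>e\<in>E. B e)" if "e \<in> E" for e
      using B(2)[OF that] span_mono[of "B e" "\<Union>e\<in>E. B e"] that by blast
    then have "(\<Sum>e\<in>E. e * x) \<in> span (\<Union>e\<in>E. B e)" by (rule span_sum)
    then show ?thesis using E(3) by (simp flip: sum_distrib_right)
  qed
  with B(1) E(1) show ?thesis by (intro exI[of _ "\<Union>e\<in>E. B e"]) auto
qed

lemma independent_imp_finite: "independent B \<Longrightarrow> finite B"
  using finite_spanning_set independent_span_bound by (metis subset_UNIV)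

lemma basis_extension:
  assumes "independent A"
  obtains B where "A \<subseteq> B" "independent B" "span B = UNIV"
  using maximal_independent_subset_extend[OF subset_UNIV assms] by (metis top.extremum_uniqueI)

lemma representation_change_basis:
  assumes B: "independent B" "span B = UNIV" and C: "independent C" "span C = UNIV"
  shows "representation B v b = (\<Sum>c\<in>C. representation C v c * representation B c b)"
proof -
  have "representation B (\<Sum>c\<in>C. scl (representation C v c) c) b
      = (\<Sum>c\<in>C. representation C v c * representation B c b)"
    using B by (simp add: representation_sum representation_scale)
  moreover have "(\<Sum>c\<in>C. scl (representation C v c) c) = v"
    using C independent_imp_finite by (intro sum_representation_eq) auto
  ultimately show ?thesis by simp
qed

text \<open>Conjugation invariance of the trace of a matrix, written in coordinates: expand through
  \<open>C\<close>, exchange the sums, and contract the two mutually inverse base change matrices.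
  It makes the choice inside \<open>alg_trace\<close> harmless.\<close>

lemma trace_change_basis:
  assumes B: "independent B" "span B = UNIV" and C: "independent C" "span C = UNIV"
  shows "(\<Sum>b\<in>B. representation B (x * b) b) = (\<Sum>c\<in>C. representation C (x * c) c)"
proof -
  have fin: "finite B" "finite C" using B C independent_imp_finite by auto
  have rep_mult: "representation C (x * b) c' = (\<Sum>c\<in>C. representation C b c * representation C (x * c) c')" for b c'
  proof -
    have "x * b = (\<Sum>c\<in>C. scl (representation C b c) (x * c))"
      using sum_representation_eq[OF C(1), of b C] C fin by (simp flip: sum_mult_scl)
    then show ?thesis
      using C by (simp add: representation_sum representation_scale)
  qed
  have "(\<Sum>b\<in>B. representation B (x * b) b)
      = (\<Sum>b\<in>B. \<Sum>c'\<in>C. \<Sum>c\<in>C. representation C b c * representation C (x * c) c' * representation B c' b)"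
  proof (rule sum.cong[OF refl])
    fix b
    show "representation B (x * b) b
        = (\<Sum>c'\<in>C. \<Sum>c\<in>C. representation C b c * representation C (x * c) c' * representation B c' b)"
      by (simp only: representation_change_basis[OF B C, of "x * b"] rep_mult[of b] sum_distrib_right)
  qed
  also have "\<dots> = (\<Sum>c'\<in>C. \<Sum>c\<in>C. \<Sum>b\<in>B. representation C b c * representation C (x * c) c' * representation B c' b)"
    by (subst sum.swap, rule sum.cong[OF refl], rule sum.swap)
  also have "\<dots> = (\<Sum>c'\<in>C. \<Sum>c\<in>C. representation C (x * c) c' * (\<Sum>b\<in>B. representation B c' b * representation C b c))"
    by (simp add: sum_distrib_left ac_simps)
  also have "\<dots> = (\<Sum>c'\<in>C. \<Sum>c\<in>C. representation C (x * c) c' * representation C c' c)"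
    unfolding representation_change_basis[OF C B, symmetric] ..
  also have "\<dots> = (\<Sum>c'\<in>C. \<Sum>c\<in>C. if c = c' then representation C (x * c) c' else 0)"
    using C by (intro sum.cong refl) (simp add: representation_basis)
  also have "\<dots> = (\<Sum>c\<in>C. representation C (x * c) c)"
    using fin by simp
  finally show ?thesis .
qed

lemma alg_trace_eq:
  assumes "independent B" "span B = UNIV"
  shows "alg_trace scl x = (\<Sum>b\<in>B. representation B (x * b) b)"
proof -
  let ?C = "SOME B. independent B \<and> span B = UNIV"
  have "independent ?C \<and> span ?C = UNIV"
    by (rule someI[of "\<lambda>B. independent B \<and> span B = UNIV"]) (use assms in blast)
  then show ?thesis
    unfolding alg_trace_def Let_def using assms by (intro trace_change_basis) auto
qed

lemma finite_basis: obtains B where "independent B" "span B = UNIV" "finite B"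
  using basis_extension[OF independent_empty] independent_imp_finite by metis

lemma alg_trace_add: "alg_trace scl (x + y) = alg_trace scl x + alg_trace scl y"
proof -
  obtain B where B: "independent B" "span B = UNIV" by (rule finite_basis)
  then show ?thesis
    by (simp add: alg_trace_eq[OF B] distrib_right representation_add sum.distrib)
qed

lemma alg_trace_scl: "alg_trace scl (scl a x) = a * alg_trace scl x"
proof -
  obtain B where B: "independent B" "span B = UNIV" by (rule finite_basis)
  then show ?thesis
    by (simp add: alg_trace_eq[OF B] scl_mult representation_scale sum_distrib_left)
qed

lemma alg_trace_zero: "alg_trace scl 0 = 0"
  using alg_trace_scl[of 0 0] by simp

lemma alg_trace_sum: "alg_trace scl (\<Sum>i\<in>I. f i) = (\<Sum>i\<in>I. alg_trace scl (f i))"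
  by (induction I rule: infinite_finite_induct) (simp_all add: alg_trace_zero alg_trace_add)

text \<open>Multiplication by \<open>e\<close> is the projection onto \<open>eK\<close>, so its
  trace is its rank. In a basis \<open>B\<close> extending a basis \<open>A\<close> of
  \<open>eK\<close>, it fixes the elements of \<open>A\<close>, and sends those outside
  \<open>A\<close> into the span of \<open>A\<close>, so that they contribute nothing to the
  diagonal.\<close>

lemma alg_trace_idempotent_pos:
  assumes e: "e * e = e" "e \<noteq> 0"
  shows "alg_trace scl e > 0"
proof -
  let ?V = "range (\<lambda>x. e * x)"
  obtain A where A: "A \<subseteq> ?V" "independent A" "?V \<subseteq> span A"
    by (rule maximal_independent_subset)
  obtain B where B: "A \<subseteq> B" "independent B" "span B = UNIV"
    using basis_extension[OF A(2)] .
  have fin: "finite B" using B independent_imp_finite by auto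
  have "representation B (e * b) b = (if b \<in> A then 1 else 0)" if "b \<in> B" for b
  proof (cases "b \<in> A")
    case True
    then have "e * b = b" using A(1) e(1) by (auto simp flip: mult.assoc)
    with True that B show ?thesis by (simp add: representation_basis)
  next
    case False
    have "e * b \<in> span A" using A(3) by blast
    then have "representation B (e * b) = representation A (e * b)"
      using B by (intro representation_extend) auto
    with False show ?thesis using representation_ne_zero[of A "e * b" b] by auto
  qed
  then have "alg_trace scl e = (\<Sum>b\<in>B. if b \<in> A then 1 else 0)"
    unfolding alg_trace_eq[OF B(2,3)] by (rule sum.cong[OF refl])
  also have "\<dots> = of_nat (card A)"
    using fin B(1) by (simp add: sum.If_cases Int_absorb1)
  finally have "alg_trace scl e = of_nat (card A)" .
  moreover have "A \<noteq> {}"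
  proof
    assume "A = {}"
    then have "range (\<lambda>x. e * x) \<subseteq> {0}" using A(3) by simp
    then have "e * 1 = 0" by blast
    with e show False by simp
  qed
  ultimately show ?thesis
    using fin B(1) by (simp add: card_gt_0_iff finite_subset)
qed

text \<open>A nonzero \<open>x\<close> has a nonzero component in some field factor, where it can be
  inverted; hence some multiple of \<open>x\<close> is the idempotent \<open>e\<close>, whose trace
  is positive.\<close>

lemma trace_form_nondegenerate:
  assumes "\<And>y. alg_trace scl (x * y) = 0"
  shows "x = 0"
proof (rule ccontr)
  assume "x \<noteq> 0"
  obtain E where E: "finite E" "\<forall>e\<in>E. field_factor scl e" "(\<Sum>e\<in>E. e) = 1"
    using product_of_number_fields by blast
  have "(\<Sum>e\<in>E. e * x) = x" using E(3) by (simp flip: sum_distrib_right)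
  with \<open>x \<noteq> 0\<close> obtain e where e: "e \<in> E" "e * x \<noteq> 0"
    by (metis sum.neutral)
  then obtain y where y: "(e * x) * (e * y) = e" and idem: "e * e = e" "e \<noteq> 0"
    using E(2) unfolding field_factor_def by blast
  have "x * (e * (e * y)) = e" using y by (simp add: ac_simps)
  then show False using assms[of "e * (e * y)"] alg_trace_idempotent_pos[OF idem] by simp
qed

lemma trace_zero_on_basis:
  assumes B: "span B = UNIV" and z: "\<And>b. b \<in> B \<Longrightarrow> alg_trace scl (z * b) = 0"
  shows "z = 0"
proof (rule trace_form_nondegenerate)
  fix y
  have "y \<in> span B" using B by simp
  then show "alg_trace scl (z * y) = 0"
    by (induction rule: span_induct_alt)
      (simp_all add: alg_trace_zero distrib_left alg_trace_add mult_scl alg_trace_scl z)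
qed

text \<open>The map \<open>\<theta>\<close> reads the traces against \<open>B\<close> as
  coordinates. It is injective by nondegeneracy, hence surjective by dimension, and
  \<open>d b\<close> is the preimage of \<open>b\<close>. The expansion holds because both sides
  have equal traces against \<open>B\<close>.\<close>

lemma trace_dual_basis:
  assumes B: "independent B" "span B = UNIV"
  shows "\<exists>d. (\<forall>b\<in>B. \<forall>b'\<in>B. alg_trace scl (d b * b') = (if b = b' then 1 else 0)) \<and>
    (\<forall>x. x = (\<Sum>b\<in>B. scl (alg_trace scl (x * b)) (d b)))"
proof -
  have fin: "finite B" using B independent_imp_finite by auto
  interpret fd: finite_dimensional_vector_space scl B
    using B fin by unfold_locales auto
  interpret pr: finite_dimensional_vector_space_pair scl B scl B ..
  define \<theta> where "\<theta> y = (\<Sum>b\<in>B. scl (alg_trace scl (y * b)) b)" for y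
  have lin: "Vector_Spaces.linear scl scl \<theta>"
    unfolding Vector_Spaces.linear_iff
    by (intro conjI allI vector_space_axioms)
      (simp_all add: \<theta>_def distrib_right alg_trace_add scale_left_distrib sum.distrib scl_mult
        alg_trace_scl scale_sum_right)
  have zero: "y = 0" if "\<theta> y = 0" for y
  proof (rule trace_zero_on_basis[OF B(2)])
    show "alg_trace scl (y * b) = 0" if "b \<in> B" for b
      using independentD[OF B(1) fin order_refl, of "\<lambda>b. alg_trace scl (y * b)"] \<open>\<theta> y = 0\<close> that
      unfolding \<theta>_def by blast
  qed
  have "inj \<theta>"
  proof (rule injI)
    fix u v assume "\<theta> u = \<theta> v"
    then have "\<theta> (u - v) = 0"
      using pr.linear_diff[OF lin] by simp
    then show "u = v" using zero by fastforce
  qed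
  then have "surj \<theta>"
    using pr.linear_injective_imp_surjective[OF lin] by simp
  then obtain d where d: "\<And>b. \<theta> (d b) = b"
    by (metis surj_f_inv_f)
  have dual: "alg_trace scl (d b * b') = (if b = b' then 1 else 0)" if "b \<in> B" "b' \<in> B" for b b'
  proof -
    have "(\<Sum>c\<in>B. scl (alg_trace scl (d b * c) - (if b = c then 1 else 0)) c) = \<theta> (d b) - b"
      using fin that by (simp add: \<theta>_def scale_left_diff_distrib sum_subtractf if_distrib[of "\<lambda>a. scl a _"] cong: if_cong)
    then have "alg_trace scl (d b * b') - (if b = b' then 1 else 0) = 0"
      using independentD[OF B(1) fin order_refl, of "\<lambda>c. alg_trace scl (d b * c) - (if b = c then 1 else 0)"] that
      by (simp add: d)
    then show ?thesis by simp
  qed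
  moreover have "x = (\<Sum>b\<in>B. scl (alg_trace scl (x * b)) (d b))" for x
  proof -
    have "x - (\<Sum>b\<in>B. scl (alg_trace scl (x * b)) (d b)) = 0" (is "?z = 0")
    proof (rule trace_zero_on_basis[OF B(2)])
      fix b' assume b': "b' \<in> B"
      have "alg_trace scl ((\<Sum>b\<in>B. scl (alg_trace scl (x * b)) (d b)) * b')
          = (\<Sum>b\<in>B. alg_trace scl (x * b) * alg_trace scl (d b * b'))"
        by (simp add: sum_distrib_right scl_mult alg_trace_sum alg_trace_scl)
      also have "\<dots> = (\<Sum>b\<in>B. if b = b' then alg_trace scl (x * b) else 0)"
        using b' by (intro sum.cong refl) (simp add: dual)
      also have "\<dots> = alg_trace scl (x * b')"
        using b' fin by simp
      finally have "alg_trace scl ((\<Sum>b\<in>B. scl (alg_trace scl (x * b)) (d b)) * b') = alg_trace scl (x * b')" .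
      moreover have "alg_trace scl (x * b') = alg_trace scl (?z * b') + alg_trace scl ((\<Sum>b\<in>B. scl (alg_trace scl (x * b)) (d b)) * b')"
        unfolding alg_trace_add[symmetric] by (simp add: algebra_simps)
      ultimately show "alg_trace scl (?z * b') = 0" by simp
    qed
    then show ?thesis by simp
  qed
  ultimately show ?thesis by blast
qed

section \<open>Full lattices\<close>

text \<open>Euclid's algorithm on the coefficients of a relation lowers the sum of their absolute values.\<close>

lemma relation_reduces_generators:
  fixes a :: "'k \<Rightarrow> int"
  assumes "finite X" and "\<exists>x\<in>X. a x \<noteq> 0" and "(\<Sum>x\<in>X. int_scale (a x) x) = 0"
  shows "\<exists>Y. finite Y \<and> card Y < card X \<and> int_module.span Y = int_module.span X"
  using assms
proof (induction "nat (\<Sum>x\<in>X. \<bar>a x\<bar>)" arbitrary: X a rule: less_induct)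
  case less
  obtain x where x: "x \<in> X" "a x \<noteq> 0" using less.prems by blast
  show ?case
  proof (cases "\<exists>y\<in>X. y \<noteq> x \<and> a y \<noteq> 0")
    case False
    then have "(\<Sum>z\<in>X. int_scale (a z) z) = int_scale (a x) x"
      using less.prems(1) x by (subst sum.remove[of _ x]) (auto simp: int_scale_eq_0_iff intro!: sum.neutral)
    with less.prems(3) x have "x = 0" by (simp add: int_scale_eq_0_iff)
    have "int_module.span (X - {x}) = int_module.span X"
      unfolding int_module.span_eq \<open>x = 0\<close>
      using int_module.span_superset[of X] int_module.span_superset[of "X - {0}"]
        int_module.span_zero[of "X - {0}"] by blast
    moreover have "card (X - {x}) < card X"
      using less.prems(1) x by (intro psubset_card_mono) auto
    ultimately show ?thesis using less.prems(1) by blast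
  next
    case True
    then obtain y' where y': "y' \<in> X" "y' \<noteq> x" "a y' \<noteq> 0" by blast
    obtain x y where xy: "x \<in> X" "y \<in> X" "x \<noteq> y" "a x \<noteq> 0" "a y \<noteq> 0" "\<bar>a y\<bar> \<le> \<bar>a x\<bar>"
      using x y' by (cases "\<bar>a x\<bar> \<le> \<bar>a y'\<bar>") auto
    \<comment> \<open>This is one Euclidean step: the sign \<open>s\<close> makes
      \<open>a x - s * a y\<close> smaller than \<open>a x\<close> in absolute value. The relation
      is rewritten by \<open>a x * x + a y * y = (a x - s * a y) * x + a y * (y + s * x)\<close>, so
      that \<open>w\<close> inherits the coefficient of \<open>y\<close>.\<close>
    define s where "s = sgn (a x) * sgn (a y)"
    have smaller: "\<bar>a x - s * a y\<bar> < \<bar>a x\<bar>"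
      using xy by (auto simp: s_def sgn_if split: if_splits)
    define w where "w = y + int_scale s x"
    define Z where "Z = insert w (X - {y})"
    have span_Z: "int_module.span Z = int_module.span X"
      unfolding int_module.span_eq
    proof
      have "w \<in> int_module.span X"
        unfolding w_def using xy
        by (intro int_module.span_add int_module.span_scale) (auto intro: int_module.span_base)
      then show "Z \<subseteq> int_module.span X"
        unfolding Z_def by (auto intro: int_module.span_base)
      have "w - int_scale s x \<in> int_module.span Z"
        using xy by (intro int_module.span_diff int_module.span_scale)
          (auto simp: Z_def intro: int_module.span_base)
      then have "y \<in> int_module.span Z" by (simp add: w_def)
      then show "X \<subseteq> int_module.span Z"
        by (auto simp: Z_def intro: int_module.span_base)
    qed
    show ?thesis
    proof (cases "w \<in> X - {y}")
      case True
      \<comment> \<open>If \<open>w\<close> coincides with a remaining generator, the set has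
        already lost an element.\<close>
      then have "Z = X - {y}" by (auto simp: Z_def)
      moreover have "card (X - {y}) < card X"
        using less.prems(1) xy by (intro psubset_card_mono) auto
      ultimately show ?thesis using span_Z less.prems(1) by blast
    next
      case False
      define X0 where "X0 = X - {y} - {x}"
      define b where "b = (\<lambda>z. if z = w then a y else if z = x then a x - s * a y else a z)"
      have fin: "finite X0" "x \<notin> X0" "y \<notin> X0"
        using less.prems(1) by (auto simp: X0_def)
      have wx: "w \<noteq> x" using False xy by auto
      have Z: "Z = insert w (insert x X0)" using xy by (auto simp: Z_def X0_def)
      have X: "X = insert y (insert x X0)" using xy by (auto simp: X0_def)
      have w: "w \<notin> X0" using False xy by (auto simp: X0_def)
      have b: "b z = a z" if "z \<in> X0" for z
        using that False by (auto simp: b_def X0_def)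
      have sum_Z: "(\<Sum>z\<in>Z. g z) = g w + (g x + (\<Sum>z\<in>X0. g z))" for g :: "'k \<Rightarrow> 'c::comm_monoid_add"
        unfolding Z using fin w wx by simp
      have sum_X: "(\<Sum>z\<in>X. g z) = g y + (g x + (\<Sum>z\<in>X0. g z))" for g :: "'k \<Rightarrow> 'c::comm_monoid_add"
        by (subst X) (use fin xy in simp)
      have "(\<Sum>z\<in>Z. int_scale (b z) z) = (\<Sum>z\<in>X. int_scale (a z) z)"
        unfolding sum_Z sum_X using b wx
        by (simp add: b_def w_def int_scale_def algebra_simps)
      moreover
      have "(\<Sum>z\<in>Z. \<bar>b z\<bar>) < (\<Sum>z\<in>X. \<bar>a z\<bar>)" "0 \<le> (\<Sum>z\<in>Z. \<bar>b z\<bar>)"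
        unfolding sum_Z sum_X using b wx smaller by (simp_all add: b_def sum_nonneg)
      then have "nat (\<Sum>z\<in>Z. \<bar>b z\<bar>) < nat (\<Sum>z\<in>X. \<bar>a z\<bar>)" by linarith
      moreover have "\<exists>z\<in>Z. b z \<noteq> 0" using xy by (auto simp: Z_def b_def)
      moreover have "finite Z" using less.prems(1) by (simp add: Z_def)
      ultimately obtain Y where "finite Y" "card Y < card Z" "int_module.span Y = int_module.span Z"
        using less.hyps[of b Z] less.prems(3) by auto
      moreover have "card Z = card X"
        by (subst X, subst Z) (use fin w wx xy in simp)
      ultimately show ?thesis using span_Z by auto
    qed
  qed
qed

text \<open>As long as the generators are dependent over the rationals, clearing denominators gives
  an integral relation, which removes a generator. The outcome is independent over the rationals, so
  that \<open>representation\<close> yields the lattice coordinates.\<close>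

lemma int_span_has_basis:
  fixes X :: "'k set"
  assumes "finite X"
  obtains B where "finite B" "independent B" "int_module.span B = int_module.span X"
proof -
  have "\<exists>B. finite B \<and> independent B \<and> int_module.span B = int_module.span X"
    using assms
  proof (induction "card X" arbitrary: X rule: less_induct)
    case less
    show ?case
    proof (cases "dependent X")
      case False
      with less.prems show ?thesis by blast
    next
      case True
      then obtain u where u: "\<exists>v\<in>X. u v \<noteq> 0" "(\<Sum>v\<in>X. scl (u v) v) = 0"
        using dependent_finite[OF less.prems] by blast
      obtain N where N: "N > 0" "\<forall>x\<in>X. of_int N * u x \<in> \<int>"
        using common_denominator[OF less.prems, of u] by blast
      define a where "a x = \<lfloor>of_int N * u x\<rfloor>" for x
      have a: "of_int (a x) = of_int N * u x" if "x \<in> X" for x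
        using N that by (auto simp: a_def elim: Ints_cases)
      have "(\<Sum>x\<in>X. int_scale (a x) x) = scl (of_int N) (\<Sum>v\<in>X. scl (u v) v)"
        unfolding scale_sum_right by (intro sum.cong refl) (simp flip: scl_of_int add: a)
      then have "(\<Sum>x\<in>X. int_scale (a x) x) = 0" by (simp add: u)
      moreover have "\<exists>x\<in>X. a x \<noteq> 0"
        using u(1) N(1) a by (metis mult_eq_0_iff of_int_0 of_int_eq_0_iff less_irrefl)
      ultimately obtain Y where Y: "finite Y" "card Y < card X" "int_module.span Y = int_module.span X"
        using relation_reduces_generators[OF less.prems] by blast
      with less.hyps[OF Y(2,1)] show ?thesis by simp
    qed
  qed
  then show thesis using that by blast
qed

text \<open>Independent of any base ring, so that ideals over \<open>R\<close>, \<open>S\<close> and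
  \<open>T\<close>, trace duals, colons and the rings themselves are instances of one notion; the
  ring reappears only as a stability condition.\<close>

definition full_lattice :: "'k set \<Rightarrow> bool" where
  "full_lattice I \<longleftrightarrow> (\<exists>X. finite X \<and> I = int_module.span X) \<and> span I = UNIV"

lemma full_lattice_subspace: "full_lattice I \<Longrightarrow> int_module.subspace I"
  by (auto simp: full_lattice_def)

lemma subspace_imp_int_subspace: "subspace V \<Longrightarrow> int_module.subspace V"
  by (auto intro!: int_module.subspaceI subspace_add subspace_0 simp flip: scl_of_int intro: subspace_scale)

lemma int_span_subset_span: "int_module.span X \<subseteq> span X"
  by (intro int_module.span_minimal subspace_imp_int_subspace span_superset) simp

lemma span_int_span: "span (int_module.span X) = span X"
  unfolding span_eq using int_span_subset_span span_superset int_module.span_superset by blast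

lemma full_lattice_basis:
  assumes "full_lattice I"
  obtains B where "finite B" "independent B" "span B = UNIV" "I = int_module.span B"
proof -
  obtain X where X: "finite X" "I = int_module.span X" "span I = UNIV"
    using assms by (auto simp: full_lattice_def)
  obtain B where B: "finite B" "independent B" "int_module.span B = int_module.span X"
    using int_span_has_basis[OF X(1)] .
  with X span_int_span[of B] have "span B = UNIV" by simp
  with B X that show thesis by simp
qed

lemma int_span_iff_representation:
  assumes B: "independent B" "span B = UNIV"
  shows "x \<in> int_module.span B \<longleftrightarrow> (\<forall>b\<in>B. representation B x b \<in> \<int>)"
proof
  assume "x \<in> int_module.span B"
  then show "\<forall>b\<in>B. representation B x b \<in> \<int>"
  proof (induction rule: int_module.span_induct_alt)
    case base
    show ?case by (simp add: representation_zero)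
  next
    case (step c x y)
    have "representation B (int_scale c x + y) b = of_int c * representation B x b + representation B y b" for b
      using B by (simp add: representation_add representation_scale flip: scl_of_int)
    with step show ?case
      using B by (auto simp: representation_basis)
  qed
next
  assume x: "\<forall>b\<in>B. representation B x b \<in> \<int>"
  have "(\<Sum>b\<in>B. scl (representation B x b) b) \<in> int_module.span B"
  proof (rule int_module.span_sum)
    fix b assume b: "b \<in> B"
    then obtain n where "representation B x b = of_int n" using x by (auto elim: Ints_cases)
    then show "scl (representation B x b) b \<in> int_module.span B"
      using b by (auto simp: scl_of_int intro: int_module.span_scale int_module.span_base)
  qed
  then show "x \<in> int_module.span B"
    using sum_representation_eq[OF B(1), of x B] B independent_imp_finite by auto
qed

lemma full_lattice_multiple:
  assumes "full_lattice I"
  shows "\<exists>N>0. int_scale N x \<in> I"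
proof -
  obtain B where B: "finite B" "independent B" "span B = UNIV" "I = int_module.span B"
    using full_lattice_basis[OF assms] .
  obtain N where N: "N > 0" "\<forall>b\<in>B. of_int N * representation B x b \<in> \<int>"
    using common_denominator[OF B(1)] by blast
  have "int_scale N x \<in> I"
    unfolding B(4) int_span_iff_representation[OF B(2,3)]
    using N B by (simp add: representation_scale flip: scl_of_int)
  with N show ?thesis by blast
qed

lemma full_lattice_common_multiple:
  assumes I: "full_lattice I" and J: "full_lattice J"
  shows "\<exists>N>0. \<forall>x\<in>J. int_scale N x \<in> I"
proof -
  note subI = full_lattice_subspace[OF I]
  obtain X where X: "finite X" "J = int_module.span X" using J by (auto simp: full_lattice_def)
  have "\<exists>N>0. \<forall>x\<in>X. int_scale N x \<in> I"
    using X(1)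
  proof (induction X)
    case empty
    show ?case by (rule exI[of _ 1]) simp
  next
    case (insert a X)
    then obtain N where N: "N > 0" "\<forall>x\<in>X. int_scale N x \<in> I" by blast
    obtain M where M: "M > 0" "int_scale M a \<in> I" using full_lattice_multiple[OF I] by blast
    have "int_scale (N * M) a \<in> I"
      using int_module.subspace_scale[OF subI M(2), of N] by simp
    moreover have "int_scale (N * M) x \<in> I" if "x \<in> X" for x
      using int_module.subspace_scale[OF subI, of "int_scale N x" M] N that by (simp add: mult.commute)
    ultimately show ?case using N M by (intro exI[of _ "N * M"]) auto
  qed
  then obtain N where N: "N > 0" "\<forall>x\<in>X. int_scale N x \<in> I" by blast
  have "int_scale N x \<in> I" if "x \<in> int_module.span X" for x
    using that
  proof (induction rule: int_module.span_induct_alt)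
    case base
    show ?case using int_module.subspace_0[OF subI] by simp
  next
    case (step c x y)
    have "int_scale N (int_scale c x + y) = int_scale c (int_scale N x) + int_scale N y"
      by (simp add: int_scale_def algebra_simps)
    with step N show ?case
      using int_module.subspace_add[OF subI] int_module.subspace_scale[OF subI]
      by (auto simp del: int_module.scale_scale)
  qed
  with N X show ?thesis by blast
qed

lemma full_lattice_finite_index:
  assumes I: "full_lattice I" and J: "full_lattice J"
  shows "finite_index I J"
proof -
  obtain N where N: "N > 0" "\<forall>x\<in>J. int_scale N x \<in> I"
    using full_lattice_common_multiple[OF assms] by blast
  obtain X where X: "finite X" "J = int_module.span X" using J by (auto simp: full_lattice_def)
  show ?thesis
    using finite_index_int_scale[OF X(1) N(1)] N(2) X(2)
    by (auto elim!: finite_index_mono)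
qed

text \<open>With \<open>n = N * M\<close>, \<open>G\<close> contains \<open>n J\<close>, and
  \<open>J / n J\<close> is finite. So \<open>G\<close> is generated by \<open>n\<close> times the
  generators of \<open>J\<close> together with the finitely many representatives lying in
  \<open>G\<close>; this replaces an appeal to Noetherian modules.\<close>

lemma full_lattice_between:
  assumes I: "full_lattice I" and J: "full_lattice J" and G: "int_module.subspace G" "G \<subseteq> J"
    and N: "N > 0" "\<And>x. x \<in> I \<Longrightarrow> int_scale N x \<in> G"
  shows "full_lattice G"
proof -
  obtain M where M: "M > 0" "\<forall>x\<in>J. int_scale M x \<in> I"
    using full_lattice_common_multiple[OF I J] by blast
  obtain X where X: "finite X" "J = int_module.span X" using J by (auto simp: full_lattice_def)
  let ?n = "N * M"
  have n: "?n > 0" using N M by simp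
  have nG: "int_scale ?n x \<in> G" if "x \<in> J" for x
    using N(2)[OF M(2)[rule_format, OF that]] by simp
  obtain Q where Q: "finite Q" "\<And>x. x \<in> J \<Longrightarrow> \<exists>q\<in>Q. x - q \<in> int_scale ?n ` J"
    using finite_index_int_scale[OF X(1) n] unfolding finite_index_def X(2)[symmetric] by blast
  let ?Y = "int_scale ?n ` X \<union> (Q \<inter> G)"
  have "G = int_module.span ?Y"
  proof
    show "int_module.span ?Y \<subseteq> G"
      using G nG X int_module.span_superset by (intro int_module.span_minimal) auto
    show "G \<subseteq> int_module.span ?Y"
    proof
      fix x assume x: "x \<in> G"
      then obtain q z where q: "q \<in> Q" and z: "z \<in> J" "x - q = int_scale ?n z"
        using Q G by blast
      have "x - (x - q) \<in> G"
        using int_module.subspace_diff[OF G(1) x, of "x - q"] nG[OF z(1)] z(2) by simp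
      then have qG: "q \<in> G" by simp
      have "int_module.span X \<subseteq> {z. int_scale ?n z \<in> int_module.span ?Y}"
        using int_module.subspace_span[of ?Y]
        by (intro int_module.span_minimal int_module.subspaceI)
          (auto intro: int_module.span_base int_module.span_zero int_module.span_add int_module.span_scale
            simp: int_module.scale_right_distrib int_module.scale_left_commute[of "N * M"] simp del: int_module.scale_scale)
      then have "int_scale ?n z \<in> int_module.span ?Y" using z(1) X(2) by blast
      then have "q + int_scale ?n z \<in> int_module.span ?Y"
        using q qG by (intro int_module.span_add) (auto intro: int_module.span_base)
      then show "x \<in> int_module.span ?Y" using z(2) by (metis add.commute diff_add_cancel)
    qed
  qed
  moreover have "v \<in> span G" for v
  proof -
    obtain K where K: "K > 0" "int_scale K v \<in> I" using full_lattice_multiple[OF I] by blast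
    have "scl (of_int (N * K)) v \<in> G" using N(2)[OF K(2)] unfolding scl_of_int by simp
    then have "scl (1 / of_int (N * K)) (scl (of_int (N * K)) v) \<in> span G"
      by (intro span_scale span_base)
    then show ?thesis using N K by simp
  qed
  ultimately show ?thesis
    unfolding full_lattice_def using Q X by blast
qed

lemma full_lattice_intermediate:
  assumes "full_lattice I" "full_lattice J" "int_module.subspace G" "I \<subseteq> G" "G \<subseteq> J"
  shows "full_lattice G"
  by (rule full_lattice_between[of I J G 1]) (use assms in auto)

lemma full_lattice_ideal_prod:
  assumes I: "full_lattice I" and J: "full_lattice J"
  shows "full_lattice (ideal_prod I J)"
proof -
  obtain X where X: "finite X" "I = int_module.span X" using I by (auto simp: full_lattice_def)
  obtain Y where Y: "finite Y" "J = int_module.span Y" using J by (auto simp: full_lattice_def)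
  have "{x * y | x y. x \<in> X \<and> y \<in> Y} = (\<lambda>(x, y). x * y) ` (X \<times> Y)" by auto
  then have "finite {x * y | x y. x \<in> X \<and> y \<in> Y}" using X Y by simp
  moreover have "ideal_prod I J = int_module.span {x * y | x y. x \<in> X \<and> y \<in> Y}"
    unfolding X Y by (rule ideal_prod_span)
  moreover have "v \<in> span (ideal_prod I J)" for v
  proof -
    obtain N where N: "N > 0" "int_scale N v \<in> I" using full_lattice_multiple[OF I] by blast
    obtain M where M: "M > 0" "int_scale M 1 \<in> J" using full_lattice_multiple[OF J] by blast
    have "int_scale N v * int_scale M 1 \<in> ideal_prod I J" using N M by (intro ideal_prodI)
    then have "scl (of_int (N * M)) v \<in> ideal_prod I J"
      unfolding scl_of_int by (simp add: int_scale_def ac_simps)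
    then have "scl (1 / of_int (N * M)) (scl (of_int (N * M)) v) \<in> span (ideal_prod I J)"
      by (intro span_scale span_base)
    then show ?thesis using N M by simp
  qed
  ultimately show ?thesis unfolding full_lattice_def by blast
qed

text \<open>This is the lattice \<open>(1/N) I\<close>; it supplies the upper bound for a colon
  ideal.\<close>

lemma full_lattice_scaled:
  assumes I: "full_lattice I" and N: "N > 0"
  shows "full_lattice {x. int_scale N x \<in> I}"
proof -
  obtain X where X: "finite X" "I = int_module.span X" "span I = UNIV"
    using I by (auto simp: full_lattice_def)
  let ?f = "scl (1 / of_int N)"
  have inv: "int_scale N (?f x) = x" "?f (int_scale N x) = x" for x
    using N by (simp_all flip: scl_of_int)
  have f: "?f (int_scale c x + y) = int_scale c (?f x) + ?f y" for c x y
    by (simp add: scale_right_distrib scale_left_commute flip: scl_of_int)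
  have "{x. int_scale N x \<in> I} = int_module.span (?f ` X)"
  proof
    show "int_module.span (?f ` X) \<subseteq> {x. int_scale N x \<in> I}"
    proof (intro int_module.span_minimal)
      show "?f ` X \<subseteq> {x. int_scale N x \<in> I}"
        using X by (auto simp: inv intro: int_module.span_base)
      show "int_module.subspace {x. int_scale N x \<in> I}"
        using full_lattice_subspace[OF I]
        by (intro int_module.subspaceI)
          (auto simp: int_module.scale_right_distrib int_module.scale_left_commute[of N] int_module.subspace_0
            simp del: int_module.scale_scale intro: int_module.subspace_add int_module.subspace_scale)
    qed
    have "?f x \<in> int_module.span (?f ` X)" if "x \<in> int_module.span X" for x
      using that
    proof (induction rule: int_module.span_induct_alt)
      case base
      show ?case by (simp add: int_module.span_zero)
    next
      case (step c x y)
      then show ?case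
        unfolding f by (intro int_module.span_add int_module.span_scale) (auto intro: int_module.span_base)
    qed
    then show "{x. int_scale N x \<in> I} \<subseteq> int_module.span (?f ` X)"
      using X inv(2) by (metis mem_Collect_eq subsetI)
  qed
  moreover have "I \<subseteq> {x. int_scale N x \<in> I}"
    using int_module.subspace_scale[OF full_lattice_subspace[OF I]] by blast
  then have "span {x. int_scale N x \<in> I} = UNIV"
    using X(3) span_mono by blast
  ultimately show ?thesis unfolding full_lattice_def using X(1) by blast
qed

text \<open>Squeezed between multiples of \<open>I\<close>: \<open>N I\<close> lies in
  \<open>(I:J)\<close> when \<open>N\<close> carries \<open>I J\<close> into \<open>I\<close>, and
  \<open>(I:J)\<close> lies in \<open>(1/M) I\<close> when the integer \<open>M\<close> belongs to
  \<open>J\<close>.\<close>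

lemma full_lattice_colon:
  assumes I: "full_lattice I" and J: "full_lattice J"
  shows "full_lattice (colon I J)"
proof -
  obtain N where N: "N > 0" "\<forall>x\<in>ideal_prod I J. int_scale N x \<in> I"
    using full_lattice_common_multiple[OF I full_lattice_ideal_prod[OF I J]] by blast
  obtain M where M: "M > 0" "int_scale M 1 \<in> J" using full_lattice_multiple[OF J] by blast
  show ?thesis
  proof (rule full_lattice_between[OF I full_lattice_scaled[OF I M(1)]])
    show "int_module.subspace (colon I J)" using I by (intro subspace_colon full_lattice_subspace)
    show "colon I J \<subseteq> {x. int_scale M x \<in> I}"
    proof
      fix x assume "x \<in> colon I J"
      then have "x * int_scale M 1 \<in> I" using M by (auto simp: colon_def)
      then show "x \<in> {x. int_scale M x \<in> I}" by (simp add: int_scale_def mult.commute)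
    qed
    show "int_scale N x \<in> colon I J" if "x \<in> I" for x
      unfolding colon_def
    proof safe
      fix y assume "y \<in> J"
      with that N have "int_scale N (x * y) \<in> I" using ideal_prodI by blast
      then show "int_scale N x * y \<in> I" by (simp add: int_scale_def mult.assoc)
    qed
  qed (rule N)
qed

section \<open>Trace duals of lattices\<close>

lemma subspace_trace_dual: "int_module.subspace (trace_dual scl I)"
  unfolding trace_dual_def
proof (intro int_module.subspaceI CollectI ballI)
  fix c x y assume "x \<in> {x. \<forall>y\<in>I. alg_trace scl (x * y) \<in> \<int>}" "y \<in> I"
  then have "of_int c * alg_trace scl (x * y) \<in> \<int>" by auto
  then show "alg_trace scl (int_scale c x * y) \<in> \<int>"
    by (simp add: scl_mult alg_trace_scl flip: scl_of_int)
qed (auto simp: alg_trace_zero distrib_right alg_trace_add)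

lemma trace_dual_int_span:
  "trace_dual scl (int_module.span B) = {x. \<forall>b\<in>B. alg_trace scl (x * b) \<in> \<int>}"
proof -
  have "alg_trace scl (x * y) \<in> \<int>"
    if "\<forall>b\<in>B. alg_trace scl (x * b) \<in> \<int>" "y \<in> int_module.span B" for x y
    using that(2)
  proof (induction rule: int_module.span_induct_alt)
    case base
    show ?case by (simp add: alg_trace_zero)
  next
    case (step c z y)
    have "alg_trace scl (x * (int_scale c z + y)) = of_int c * alg_trace scl (x * z) + alg_trace scl (x * y)"
      by (simp add: distrib_left alg_trace_add mult_scl alg_trace_scl flip: scl_of_int)
    with step that(1) show ?case by auto
  qed
  then show ?thesis
    unfolding trace_dual_def using int_module.span_base by blast
qed

text \<open>The basis dual to a lattice basis \<open>B\<close> generates the trace dual. The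
  coordinate of \<open>x\<close> at \<open>b\<close> is the trace of \<open>x * d b\<close>, so
  integrality of traces against the dual puts \<open>x\<close> back in \<open>I\<close>; this is the
  nontrivial half of double duality.\<close>

lemma trace_dual_full_lattice:
  assumes "full_lattice I"
  shows "full_lattice (trace_dual scl I)" "trace_dual scl (trace_dual scl I) \<subseteq> I"
proof -
  obtain B where B: "finite B" "independent B" "span B = UNIV" "I = int_module.span B"
    using full_lattice_basis[OF assms] .
  obtain d where d: "\<And>b b'. b \<in> B \<Longrightarrow> b' \<in> B \<Longrightarrow> alg_trace scl (d b * b') = (if b = b' then 1 else 0)"
    and expand: "\<And>x. x = (\<Sum>b\<in>B. scl (alg_trace scl (x * b)) (d b))"
    using trace_dual_basis[OF B(2,3)] by blast
  have dual: "trace_dual scl I = {x. \<forall>b\<in>B. alg_trace scl (x * b) \<in> \<int>}"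
    unfolding B(4) by (rule trace_dual_int_span)
  have d_dual: "d b \<in> trace_dual scl I" if "b \<in> B" for b
    unfolding dual using that by (auto simp: d)
  have "trace_dual scl I = int_module.span (d ` B)"
  proof
    show "int_module.span (d ` B) \<subseteq> trace_dual scl I"
      using d_dual by (intro int_module.span_minimal subspace_trace_dual) auto
    show "trace_dual scl I \<subseteq> int_module.span (d ` B)"
    proof
      fix x assume x: "x \<in> trace_dual scl I"
      have "(\<Sum>b\<in>B. scl (alg_trace scl (x * b)) (d b)) \<in> int_module.span (d ` B)"
      proof (rule int_module.span_sum)
        fix b assume b: "b \<in> B"
        then obtain n where "alg_trace scl (x * b) = of_int n" using x by (auto simp: dual elim: Ints_cases)
        then show "scl (alg_trace scl (x * b)) (d b) \<in> int_module.span (d ` B)"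
          using b by (auto simp: scl_of_int intro: int_module.span_scale int_module.span_base)
      qed
      then show "x \<in> int_module.span (d ` B)" by (simp flip: expand)
    qed
  qed
  moreover have "x \<in> span (d ` B)" for x
    by (subst expand[of x]) (auto intro: span_sum span_scale span_base)
  then have "span (int_module.span (d ` B)) = UNIV" by (auto simp: span_int_span)
  ultimately show "full_lattice (trace_dual scl I)"
    unfolding full_lattice_def using B(1) by (metis finite_imageI)
  show "trace_dual scl (trace_dual scl I) \<subseteq> I"
  proof
    fix x assume x: "x \<in> trace_dual scl (trace_dual scl I)"
    have "representation B x b \<in> \<int>" if b: "b \<in> B" for b
    proof -
      have "x = (\<Sum>b\<in>B. scl (representation B x b) b)"
        using sum_representation_eq[OF B(2), of x B] B by simp
      then have "alg_trace scl (x * d b) = alg_trace scl (d b * (\<Sum>b\<in>B. scl (representation B x b) b))"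
        by (metis mult.commute)
      also have "\<dots> = (\<Sum>b'\<in>B. representation B x b' * alg_trace scl (d b * b'))"
        by (simp add: sum_mult_scl alg_trace_sum alg_trace_scl)
      also have "\<dots> = (\<Sum>b'\<in>B. if b' = b then representation B x b' else 0)"
        using b by (intro sum.cong refl) (simp add: d)
      also have "\<dots> = representation B x b" using B b by simp
      finally show ?thesis using x d_dual[OF b] by (auto simp: trace_dual_def)
    qed
    then show "x \<in> I" unfolding B(4) using B by (subst int_span_iff_representation) auto
  qed
qed

end

section \<open>Subgroups of the quotient\<close>

lemma submodule_over_imp_subspace:
  assumes "unital_subring R" and "submodule_over R M"
  shows "int_module.subspace M"
proof (rule int_module.subspaceI)
  fix c x assume "x \<in> M"
  moreover have "of_int c \<in> R"
    using int_module.subspace_scale[OF unital_subringD(2,1)[OF assms(1)], of c] by (simp add: int_scale_def)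
  ultimately show "int_scale c x \<in> M"
    using assms(2) by (simp add: submodule_over_def int_scale_def)
qed (use assms(2) in \<open>auto simp: submodule_over_def\<close>)

lemma submodule_over_gen_submodule: "submodule_over R (gen_submodule R X)"
  unfolding gen_submodule_def by (rule hull_in) (auto simp: submodule_over_def)

lemma gen_submodule_eq: "submodule_over R M \<Longrightarrow> gen_submodule R M = M"
  unfolding gen_submodule_def by (rule hull_same)

lemma submodule_over_ideal_prod:
  assumes "\<And>r x. r \<in> R \<Longrightarrow> x \<in> J \<Longrightarrow> r * x \<in> J"
  shows "submodule_over R (ideal_prod I J)"
  unfolding submodule_over_def
  using ideal_prod_mult_closed[OF _ assms] int_module.subspace_0[OF subspace_ideal_prod]
    int_module.subspace_add[OF subspace_ideal_prod] by blast

text \<open>Replaces the hull by a product, so that generation over \<open>R\<close> turns into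
  generation over the integers by products of generators.\<close>

lemma gen_submodule_eq_ideal_prod:
  assumes R: "unital_subring R"
  shows "gen_submodule R X = ideal_prod R (int_module.span X)"
proof
  note R' = unital_subringD[OF R]
  show "gen_submodule R X \<subseteq> ideal_prod R (int_module.span X)"
    unfolding gen_submodule_def
  proof (rule hull_minimal)
    show "X \<subseteq> ideal_prod R (int_module.span X)"
      using ideal_prodI[OF R'(1) int_module.span_base] by auto
    show "submodule_over R (ideal_prod R (int_module.span X))"
      unfolding ideal_prod_commute[of R] by (rule submodule_over_ideal_prod) (rule R'(3))
  qed
  note sub = submodule_over_gen_submodule[of R X]
  have "X \<subseteq> gen_submodule R X" unfolding gen_submodule_def by (rule hull_subset)
  then have "int_module.span X \<subseteq> gen_submodule R X"
    using submodule_over_imp_subspace[OF R sub] by (intro int_module.span_minimal)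
  then show "ideal_prod R (int_module.span X) \<subseteq> gen_submodule R X"
    using sub submodule_over_imp_subspace[OF R sub]
    by (intro ideal_prod_minimal) (auto simp: submodule_over_def)
qed

lemma ideal_prod_unital:
  assumes "int_module.subspace I" and "1 \<in> S" and "\<And>s x. s \<in> S \<Longrightarrow> x \<in> I \<Longrightarrow> s * x \<in> I"
  shows "ideal_prod I S = I"
proof
  show "ideal_prod I S \<subseteq> I"
    using assms by (intro ideal_prod_minimal) (metis mult.commute)+
  show "I \<subseteq> ideal_prod I S"
    using ideal_prodI[OF _ assms(2), of _ I] by auto
qed

lemma ideal_prod_mono: "I \<subseteq> I' \<Longrightarrow> J \<subseteq> J' \<Longrightarrow> ideal_prod I J \<subseteq> ideal_prod I' J'"
  by (intro ideal_prod_minimal subspace_ideal_prod) (auto intro: ideal_prodI)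

lemma colon_self_of_subring:
  assumes "unital_subring S"
  shows "colon S S = S"
  using unital_subringD[OF assms] by (force simp: colon_def)

lemma subgroup_additive_group_of:
  assumes T: "int_module.subspace T" and G: "int_module.subspace G" "G \<subseteq> T"
  shows "comm_group (additive_group_of T)" "subgroup G (additive_group_of T)"
proof -
  show grp: "comm_group (additive_group_of T)"
  proof (rule comm_groupI)
    fix x assume x: "x \<in> carrier (additive_group_of T)"
    then have "- x \<in> T" using int_module.subspace_neg[OF T] by (simp add: additive_group_of_def)
    then show "\<exists>y\<in>carrier (additive_group_of T). y \<otimes>\<^bsub>additive_group_of T\<^esub> x = \<one>\<^bsub>additive_group_of T\<^esub>"
      by (intro bexI[of _ "- x"]) (auto simp: additive_group_of_def)
  qed (auto simp: additive_group_of_def ac_simps int_module.subspace_0[OF T] int_module.subspace_add[OF T])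
  interpret comm_group "additive_group_of T" by (rule grp)
  show "subgroup G (additive_group_of T)"
  proof (rule subgroupI)
    fix x assume x: "x \<in> G"
    have "inv\<^bsub>additive_group_of T\<^esub> x = - x"
      using x G int_module.subspace_neg[OF T]
      by (intro inv_equality) (auto simp: additive_group_of_def)
    then show "inv\<^bsub>additive_group_of T\<^esub> x \<in> G"
      using int_module.subspace_neg[OF G(1) x] by simp
  qed (use G int_module.subspace_0[OF G(1)] int_module.subspace_add[OF G(1)]
      in \<open>auto simp: additive_group_of_def\<close>)
qed

lemma r_coset_eq_iff:
  assumes F: "int_module.subspace F"
  shows "F #>\<^bsub>additive_group_of T\<^esub> x = F #>\<^bsub>additive_group_of T\<^esub> y \<longleftrightarrow> x - y \<in> F"
proof -
  have coset: "F #>\<^bsub>additive_group_of T\<^esub> x = {z. z - x \<in> F}" for x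
    by (force simp: r_coset_def additive_group_of_def)
  show ?thesis
  proof
    assume "F #>\<^bsub>additive_group_of T\<^esub> x = F #>\<^bsub>additive_group_of T\<^esub> y"
    then have "{z. z - x \<in> F} = {z. z - y \<in> F}" by (simp add: coset)
    moreover have "x - x \<in> F" using int_module.subspace_0[OF F] by simp
    ultimately show "x - y \<in> F" by blast
  next
    assume xy: "x - y \<in> F"
    have "z - x \<in> F \<longleftrightarrow> z - y \<in> F" for z
      using int_module.subspace_add[OF F xy, of "z - x"] int_module.subspace_diff[OF F _ xy, of "z - y"]
      by auto
    then show "F #>\<^bsub>additive_group_of T\<^esub> x = F #>\<^bsub>additive_group_of T\<^esub> y" by (simp add: coset)
  qed
qed

lemma finite_quotient_subgroups:
  assumes S: "unital_subring S" and T: "unital_subring T"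
    and index: "finite_index (colon S T) T"
  shows "finite (quotient_subgroups S T)"
proof -
  let ?F = "colon S T" and ?G = "additive_group_of T"
  note F = colon_subring(1)[OF S T]
  obtain Q where Q: "finite Q" "\<And>x. x \<in> T \<Longrightarrow> \<exists>q\<in>Q. x - q \<in> ?F"
    using index by (auto simp: finite_index_def)
  have "carrier (?G Mod ?F) \<subseteq> (\<lambda>q. ?F #>\<^bsub>?G\<^esub> q) ` Q"
  proof
    fix c assume "c \<in> carrier (?G Mod ?F)"
    then obtain x where x: "x \<in> T" "c = ?F #>\<^bsub>?G\<^esub> x"
      by (auto simp: FactGroup_def RCOSETS_def additive_group_of_def)
    with Q obtain q where "q \<in> Q" "x - q \<in> ?F" by blast
    then show "c \<in> (\<lambda>q. ?F #>\<^bsub>?G\<^esub> q) ` Q"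
      using x(2) r_coset_eq_iff[OF F] by blast
  qed
  then have "finite (carrier (?G Mod ?F))" using Q(1) finite_subset by blast
  moreover have "quotient_subgroups S T \<subseteq> Pow (carrier (?G Mod ?F))"
    by (auto simp: quotient_subgroups_def dest: subgroup.subset)
  ultimately show ?thesis by (meson finite_Pow_iff finite_subset)
qed

lemma candidate_ideal_bounds:
  assumes S: "unital_subring S" and T: "unital_subring T" and "S \<subseteq> T"
    and H: "H \<in> quotient_subgroups S T"
  shows "submodule_over S (candidate_ideal S T H)" "colon S T \<subseteq> candidate_ideal S T H"
    "candidate_ideal S T H \<subseteq> T"
proof -
  let ?F = "colon S T" and ?G = "additive_group_of T"
  note F = colon_subring[OF S T] and T' = unital_subringD[OF T]
  let ?X = "{x \<in> T. ?F #>\<^bsub>?G\<^esub> x \<in> H}"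
  show "submodule_over S (candidate_ideal S T H)"
    unfolding candidate_ideal_def by (rule submodule_over_gen_submodule)
  have "?F #>\<^bsub>?G\<^esub> 0 = ?F" by (auto simp: r_coset_def additive_group_of_def)
  then have "?F #>\<^bsub>?G\<^esub> x = ?F" if "x \<in> ?F" for x
    using r_coset_eq_iff[OF F(1), of T x 0] that by simp
  moreover have "\<one>\<^bsub>?G Mod ?F\<^esub> \<in> H"
    using H subgroup.one_closed unfolding quotient_subgroups_def by blast
  then have "?F \<in> H" by (simp add: FactGroup_def)
  ultimately have "?F #>\<^bsub>?G\<^esub> x \<in> H" if "x \<in> ?F" for x
    using that by simp
  then have "?F \<subseteq> ?X" using F(2) \<open>S \<subseteq> T\<close> by auto
  then show "?F \<subseteq> candidate_ideal S T H"
    unfolding candidate_ideal_def gen_submodule_def by (rule order_trans[OF _ hull_subset])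
  show "candidate_ideal S T H \<subseteq> T"
    unfolding candidate_ideal_def gen_submodule_def
    using T' \<open>S \<subseteq> T\<close> int_module.subspace_0[OF T'(2)] int_module.subspace_add[OF T'(2)]
    by (intro hull_minimal) (auto simp: submodule_over_def)
qed

text \<open>Take for \<open>H\<close> the image of \<open>J\<close> in the quotient. Its preimage is
  exactly \<open>J\<close> because \<open>J\<close> contains the conductor, and \<open>J\<close> is
  already stable under \<open>S\<close>, so generating adds nothing.\<close>

lemma candidate_ideal_surj:
  assumes S: "unital_subring S" and T: "unital_subring T" and "S \<subseteq> T"
    and J: "submodule_over S J" "colon S T \<subseteq> J" "J \<subseteq> T"
  obtains H where "H \<in> quotient_subgroups S T" "candidate_ideal S T H = J"
proof -
  let ?F = "colon S T" and ?G = "additive_group_of T"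
  note F = colon_subring[OF S T] and T' = unital_subringD[OF T]
  have Jsub: "int_module.subspace J" by (rule submodule_over_imp_subspace[OF S J(1)])
  have "?F \<subseteq> T" using F(2) \<open>S \<subseteq> T\<close> by blast
  interpret G: comm_group ?G
    by (rule subgroup_additive_group_of(1)[OF T'(2) F(1) \<open>?F \<subseteq> T\<close>])
  have "subgroup ?F ?G"
    by (rule subgroup_additive_group_of(2)[OF T'(2) F(1) \<open>?F \<subseteq> T\<close>])
  then interpret N: normal ?F ?G by (rule G.subgroup_imp_normal)
  interpret h: group_hom ?G "?G Mod ?F" "\<lambda>x. ?F #>\<^bsub>?G\<^esub> x"
    using N.r_coset_hom_Mod N.factorgroup_is_group G.is_group
    by (simp add: group_hom_def group_hom_axioms_def)
  define H where "H = (\<lambda>x. ?F #>\<^bsub>?G\<^esub> x) ` J"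
  show thesis
  proof
    show "H \<in> quotient_subgroups S T"
      unfolding quotient_subgroups_def H_def
      using h.subgroup_img_is_subgroup subgroup_additive_group_of(2)[OF T'(2) Jsub J(3)] by blast
    have "{x \<in> T. ?F #>\<^bsub>?G\<^esub> x \<in> H} = J"
    proof (intro equalityI subsetI)
      fix x assume "x \<in> {x \<in> T. ?F #>\<^bsub>?G\<^esub> x \<in> H}"
      then obtain j where j: "j \<in> J" "x - j \<in> ?F"
        unfolding H_def using r_coset_eq_iff[OF F(1)] by blast
      then have "(x - j) + j \<in> J" using J(2) by (intro int_module.subspace_add[OF Jsub]) auto
      then show "x \<in> J" by simp
    qed (use J(3) in \<open>auto simp: H_def\<close>)
    then show "candidate_ideal S T H = J"
      unfolding candidate_ideal_def using gen_submodule_eq[OF J(1)] by simp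
  qed
qed

section \<open>Representatives\<close>

text \<open>Loop invariants, by induction on the visited prefix. \<open>sorted_wrt\<close> compares
  earlier with later entries, which is what the test checks on appending; symmetry supplies the rest
  afterwards.\<close>

lemma foldl_append_if_new:
  fixes test :: "'k::comm_ring_1 set \<Rightarrow> bool"
  assumes "sorted_wrt (\<lambda>I J. \<not> weakly_equivalent I J) L0"
  defines "L \<equiv> \<lambda>Is. foldl (append_if_new test) L0 Is"
  shows "sorted_wrt (\<lambda>I J. \<not> weakly_equivalent I J) (L Is)"
    "set (L Is) \<subseteq> set L0 \<union> {I \<in> set Is. test I}" "set L0 \<subseteq> set (L Is)"
    "\<forall>I\<in>set Is. test I \<longrightarrow> (\<exists>J\<in>set (L Is). weakly_equivalent J I)"
proof (induction Is rule: rev_induct)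
  case (snoc I Is)
  have step: "L (Is @ [I]) = append_if_new test (L Is) I" by (simp add: L_def)
  {
    case 1
    show ?case unfolding step append_if_new_def using snoc(1) by (auto simp: sorted_wrt_append)
  next
    case 2
    show ?case unfolding step append_if_new_def using snoc(2) by auto
  next
    case 3
    show ?case unfolding step append_if_new_def using snoc(3) by auto
  next
    case 4
    show ?case unfolding step append_if_new_def using snoc(4) weakly_equivalent_refl by auto
  }
qed (use assms(1) in \<open>auto simp: L_def\<close>)

lemma sorted_wrt_inequivalent_nth:
  assumes "sorted_wrt (\<lambda>I J. \<not> weakly_equivalent I J) L" "i < length L" "j < length L" "i \<noteq> j"
  shows "\<not> weakly_equivalent (L ! i) (L ! j)"
  using assms sorted_wrt_nth_less[OF assms(1)] weakly_equivalent_sym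
  by (cases i j rule: linorder_cases) blast+

lemma list_of_representatives_weak_classes:
  fixes scl :: "rat \<Rightarrow> 'k::comm_ring_1 \<Rightarrow> 'k" and R S :: "'k set"
  defines "A \<equiv> ideals_with_multiplicator_ring scl R S"
  assumes L: "sorted_wrt (\<lambda>I J. \<not> weakly_equivalent I J) L" "set L \<subseteq> A"
    and cover: "\<And>I. I \<in> A \<Longrightarrow> \<exists>J\<in>set L. weakly_equivalent J I"
  shows "list_of_representatives L (weak_classes scl R S)"
proof -
  let ?r = "{(I, J). I \<in> A \<and> J \<in> A \<and> weakly_equivalent I J}"
  have inequiv: "I = J" if "I \<in> set L" "J \<in> set L" "weakly_equivalent I J" for I J
    using that sorted_wrt_inequivalent_nth[OF L(1)] by (metis in_set_conv_nth)
  have "distinct L"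
    unfolding distinct_conv_nth
    using sorted_wrt_inequivalent_nth[OF L(1)] weakly_equivalent_refl by metis
  moreover have "set L \<subseteq> \<Union>(A // ?r)"
    using L(2) weakly_equivalent_refl by (fastforce simp: quotient_def)
  moreover have "\<exists>!x. x \<in> set L \<and> x \<in> C" if "C \<in> A // ?r" for C
  proof -
    obtain I where I: "I \<in> A" and C: "C = {J \<in> A. weakly_equivalent I J}"
      using \<open>C \<in> A // ?r\<close> by (auto simp: quotient_def)
    obtain J where J: "J \<in> set L" "weakly_equivalent J I" using cover[OF I] by blast
    show ?thesis
    proof (rule ex1I[of _ J])
      show "J \<in> set L \<and> J \<in> C" using J L(2) C weakly_equivalent_sym by blast
      show "K = J" if "K \<in> set L \<and> K \<in> C" for K
        using that J inequiv[of J K] weakly_equivalent_trans C by blast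
    qed
  qed
  ultimately show ?thesis
    unfolding list_of_representatives_def weak_classes_def Let_def A_def[symmetric] by blast
qed

context etale_algebra
begin

section \<open>Over-orders\<close>

text \<open>\<open>R\<close> is itself finitely generated over the integers, so for
  \<open>R\<close>-modules finite generation over \<open>R\<close> and over the integers
  agree.\<close>

lemma fractional_ideal_iff:
  assumes R: "unital_subring R" and fg: "finite B" "R = int_module.span B"
  shows "fractional_ideal scl R I \<longleftrightarrow> full_lattice I \<and> submodule_over R I"
proof
  assume "fractional_ideal scl R I"
  then obtain X where X: "finite X" "I = gen_submodule R X" "span I = UNIV"
    unfolding fractional_ideal_def by blast
  have "{x * y | x y. x \<in> B \<and> y \<in> X} = (\<lambda>(x, y). x * y) ` (B \<times> X)" by auto
  then have "finite {x * y | x y. x \<in> B \<and> y \<in> X}" using X fg by simp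
  moreover have "I = int_module.span {x * y | x y. x \<in> B \<and> y \<in> X}"
    unfolding X(2) gen_submodule_eq_ideal_prod[OF R] unfolding fg(2) by (rule ideal_prod_span)
  ultimately have "full_lattice I" using X(3) unfolding full_lattice_def by blast
  then show "full_lattice I \<and> submodule_over R I"
    using X(2) submodule_over_gen_submodule by blast
next
  assume I: "full_lattice I \<and> submodule_over R I"
  then obtain X where X: "finite X" "I = int_module.span X" "span I = UNIV"
    by (auto simp: full_lattice_def)
  have "gen_submodule R X = ideal_prod I R"
    unfolding X(2) gen_submodule_eq_ideal_prod[OF R] by (rule ideal_prod_commute)
  also have "\<dots> = I"
    using I unital_subringD[OF R] full_lattice_subspace
    by (intro ideal_prod_unital) (auto simp: submodule_over_def)
  finally show "fractional_ideal scl R I"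
    unfolding fractional_ideal_def using X by blast
qed

text \<open>Orders without a reference ring: by \<open>over_order_iff\<close>, the over-orders of
  \<open>R\<close> are the lattice rings containing it, which makes over-orders of \<open>S\<close>
  and of \<open>R\<close> comparable.\<close>

definition lattice_ring :: "'k set \<Rightarrow> bool" where
  "lattice_ring S \<longleftrightarrow> unital_subring S \<and> full_lattice S"

lemma submodule_over_unital_iff:
  assumes "unital_subring T"
  shows "submodule_over S T \<longleftrightarrow> S \<subseteq> T"
proof
  assume "submodule_over S T"
  then have "s * 1 \<in> T" if "s \<in> S" for s
    using that unital_subringD(1)[OF assms] unfolding submodule_over_def by blast
  then show "S \<subseteq> T" by auto
next
  assume "S \<subseteq> T"
  then show "submodule_over S T"
    using unital_subringD[OF assms] int_module.subspace_0 int_module.subspace_add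
    unfolding submodule_over_def by blast
qed

lemma over_order_iff:
  assumes "unital_subring R" "finite B" "R = int_module.span B"
  shows "over_order scl R T \<longleftrightarrow> lattice_ring T \<and> R \<subseteq> T"
  unfolding over_order_def fractional_ideal_iff[OF assms] lattice_ring_def
  using submodule_over_unital_iff by blast

lemma over_order_lattice_ring_iff:
  assumes "lattice_ring S"
  shows "over_order scl S T \<longleftrightarrow> lattice_ring T \<and> S \<subseteq> T"
proof -
  obtain B where "unital_subring S" "finite B" "S = int_module.span B"
    using assms unfolding lattice_ring_def full_lattice_def by blast
  from over_order_iff[OF this] show ?thesis .
qed

section \<open>From duality to invertibility over \<open>T\<close>\<close>

text \<open>If \<open>x\<close> is in the dual of \<open>I I^t\<close>, then \<open>x I\<close>
  pairs integrally with \<open>I^t\<close>, so \<open>x I\<close> lies in the double dual of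
  \<open>I\<close>, hence in \<open>I\<close>. Thus the dual of \<open>I I^t\<close> lies in
  \<open>(I:I)\<close>; dualising once more gives the hard inclusion.\<close>

lemma trace_dual_colon_self:
  assumes I: "full_lattice I"
  shows "trace_dual scl (colon I I) = ideal_prod I (trace_dual scl I)"
proof
  let ?D = "trace_dual scl I"
  let ?P = "ideal_prod I ?D"
  have P: "full_lattice ?P"
    by (intro full_lattice_ideal_prod trace_dual_full_lattice I)
  have "trace_dual scl ?P \<subseteq> colon I I"
  proof
    fix x assume x: "x \<in> trace_dual scl ?P"
    have "x * i \<in> I" if i: "i \<in> I" for i
    proof -
      have "x * i \<in> trace_dual scl ?D"
        using x ideal_prodI[OF i, of _ ?D] by (auto simp: trace_dual_def mult.assoc)
      then show ?thesis using trace_dual_full_lattice(2)[OF I] by blast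
    qed
    then show "x \<in> colon I I" by (simp add: colon_def)
  qed
  then have "trace_dual scl (colon I I) \<subseteq> trace_dual scl (trace_dual scl ?P)"
    by (auto simp: trace_dual_def)
  then show "trace_dual scl (colon I I) \<subseteq> ?P"
    using trace_dual_full_lattice(2)[OF P] by blast
  show "?P \<subseteq> trace_dual scl (colon I I)"
  proof (intro ideal_prod_minimal subspace_trace_dual)
    fix i d assume "i \<in> I" "d \<in> ?D"
    then have "alg_trace scl (d * (s * i)) \<in> \<int>" if "s \<in> colon I I" for s
      using that by (auto simp: trace_dual_def colon_def)
    then show "i * d \<in> trace_dual scl (colon I I)"
      by (simp add: trace_dual_def ac_simps)
  qed
qed

text \<open>Since \<open>S^t T = (I T)(I^t T)\<close>, the ideal \<open>(I^t T)(T : S^t T)\<close>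
  is an inverse of \<open>I T\<close>. The generators \<open>d * t * y\<close> of this inverse are
  the elements treated in \<open>colonP\<close>.\<close>

lemma extension_invertible:
  assumes I: "full_lattice I" and S: "colon I I = S" and T: "unital_subring T"
    and inv: "1 \<in> ideal_prod (ideal_prod (trace_dual scl S) T) (colon T (ideal_prod (trace_dual scl S) T))"
  shows "1 \<in> ideal_prod (ideal_prod I T) (colon T (ideal_prod I T))"
proof -
  note T' = unital_subringD[OF T]
  let ?D = "trace_dual scl I"
  let ?U = "ideal_prod (trace_dual scl S) T"
  let ?P = "ideal_prod I T"
  let ?W = "ideal_prod ?P (colon T ?P)"
  have St: "trace_dual scl S = ideal_prod I ?D" using trace_dual_colon_self[OF I] S by simp
  have "ideal_prod ?U (colon T ?U) \<subseteq> ?W"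
  proof (intro ideal_prod_minimal subspace_ideal_prod)
    fix u y assume u: "u \<in> ?U" and y: "y \<in> colon T ?U"
    have U: "y * (i * d * t) \<in> T" if "i \<in> I" "d \<in> ?D" "t \<in> T" for i d t
      using y that ideal_prodI[OF ideal_prodI[of i I d ?D]] unfolding St colon_def by blast
    have colonP: "d * t * y \<in> colon T ?P" if d: "d \<in> ?D" and t: "t \<in> T" for d t
    proof -
      have "?P \<subseteq> {p. p * (d * t * y) \<in> T}"
      proof (intro ideal_prod_minimal subspace_mult_preimage T'(2) CollectI)
        fix i t' assume "i \<in> I" "t' \<in> T"
        with U[OF _ d T'(3)[OF t]] have "y * (i * d * (t * t')) \<in> T" by blast
        then show "i * t' * (d * t * y) \<in> T" by (simp add: ac_simps)
      qed
      then show ?thesis unfolding colon_def by (auto simp: mult.commute)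
    qed
    have "?U \<subseteq> {u. u * y \<in> ?W}"
    proof (intro ideal_prod_minimal subspace_mult_preimage subspace_ideal_prod)
      fix s t assume s: "s \<in> trace_dual scl S" and t: "t \<in> T"
      have "ideal_prod I ?D \<subseteq> {s. s * (t * y) \<in> ?W}"
      proof (intro ideal_prod_minimal subspace_mult_preimage subspace_ideal_prod CollectI)
        fix i d assume i: "i \<in> I" and d: "d \<in> ?D"
        have "(i * 1) * (d * t * y) \<in> ?W"
          by (intro ideal_prodI colonP i d t T'(1))
        then show "i * d * (t * y) \<in> ?W" by (simp add: mult.assoc)
      qed
      then show "s * t \<in> {u. u * y \<in> ?W}" using s St by (auto simp: mult.assoc)
    qed
    then show "u * y \<in> ?W" using u by blast
  qed
  then show ?thesis using inv by blast
qed

section \<open>Existence of a suitable over-order\<close>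

text \<open>In an integral basis of \<open>T\<close>, multiplication by an element of
  \<open>T\<close> has an integer matrix.\<close>

lemma alg_trace_lattice_ring:
  assumes T: "lattice_ring T" and x: "x \<in> T"
  shows "alg_trace scl x \<in> \<int>"
proof -
  obtain B where B: "finite B" "independent B" "span B = UNIV" "T = int_module.span B"
    using full_lattice_basis T unfolding lattice_ring_def by blast
  have "representation B (x * b) b \<in> \<int>" if "b \<in> B" for b
  proof -
    have "x * b \<in> T"
      using T x that unital_subringD(3) B(4) int_module.span_base unfolding lattice_ring_def by blast
    then show ?thesis
      using that int_span_iff_representation[OF B(2,3)] B(4) by blast
  qed
  then show ?thesis
    unfolding alg_trace_eq[OF B(2,3)] by (intro Ints_sum)
qed

lemma maximal_over_order_exists:
  assumes S: "lattice_ring S"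
  obtains T where "lattice_ring T" "S \<subseteq> T" "\<And>D. lattice_ring D \<Longrightarrow> T \<subseteq> D \<Longrightarrow> D = T"
proof -
  let ?W = "{T. lattice_ring T \<and> S \<subseteq> T}"
  have index: "finite_index S (trace_dual scl S)"
    using S trace_dual_full_lattice(1) full_lattice_finite_index unfolding lattice_ring_def by blast
  have "T \<subseteq> trace_dual scl S" if T: "lattice_ring T" "S \<subseteq> T" for T
    unfolding trace_dual_def
  proof (intro subsetI CollectI ballI)
    fix x y assume "x \<in> T" "y \<in> S"
    then have "x * y \<in> T" using T unital_subringD(3) unfolding lattice_ring_def by blast
    then show "alg_trace scl (x * y) \<in> \<int>" by (rule alg_trace_lattice_ring[OF T(1)])
  qed
  then have "?W \<subseteq> {G. int_module.subspace G \<and> S \<subseteq> G \<and> G \<subseteq> trace_dual scl S}"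
    unfolding lattice_ring_def using unital_subringD(2) by blast
  then have "finite ?W"
    using finite_subgroups_between[OF index] by (rule finite_subset)
  moreover have "?W \<noteq> {}" using S by blast
  ultimately obtain T where T: "T \<in> ?W" "\<And>D. D \<in> ?W \<Longrightarrow> T \<subseteq> D \<Longrightarrow> T = D"
    using finite_has_maximal[of ?W] by (metis (no_types, lifting))
  show thesis
  proof (rule that)
    show "lattice_ring T" "S \<subseteq> T" using T(1) by auto
    show "D = T" if "lattice_ring D" "T \<subseteq> D" for D
      using T(2)[of D] that \<open>S \<subseteq> T\<close> by blast
  qed
qed

text \<open>
  By maximality $V = U(T:U)$ satisfies $(T:V) \subseteq T$. If $NT \subseteq V$, this says that no
  nonzero element of the finite ring $T/NT$ is annihilated by \<open>V\<close>, which forces $1 \in V$.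
\<close>

lemma maximal_order_invertible:
  assumes T: "lattice_ring T" and max: "\<And>D. lattice_ring D \<Longrightarrow> T \<subseteq> D \<Longrightarrow> D = T"
    and U: "full_lattice U"
  shows "1 \<in> ideal_prod U (colon T U)"
proof -
  have ringT: "unital_subring T" and latT: "full_lattice T"
    using T by (auto simp: lattice_ring_def)
  note T' = unital_subringD[OF ringT]
  let ?Q = "colon T U"
  define V where "V = ideal_prod U ?Q"
  have Q: "full_lattice ?Q" by (rule full_lattice_colon[OF latT U])
  have V: "full_lattice V" unfolding V_def by (rule full_lattice_ideal_prod[OF U Q])
  have Vsub: "int_module.subspace V" by (rule full_lattice_subspace[OF V])
  have VT: "V \<subseteq> T"
    unfolding V_def using T'(2)
    by (intro ideal_prod_minimal) (auto simp: colon_def, metis mult.commute)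
  have Vmult: "v * t \<in> V" if "v \<in> V" "t \<in> T" for v t
  proof -
    have "t * v \<in> V"
      using that T'(3) unfolding V_def by (auto intro!: ideal_prod_mult_closed simp: colon_def mult.assoc)
    then show ?thesis by (simp add: mult.commute)
  qed
  \<comment> \<open>Source of \<open>(T:V)\<close> being contained in \<open>T\<close>: the
    multiplicator ring of \<open>?Q\<close> contains \<open>T\<close>, so it equals \<open>T\<close>
    by maximality. If \<open>x V\<close> lies in \<open>T\<close>, then \<open>x * q * u\<close> is
    in \<open>T\<close> for all \<open>u\<close> in \<open>U\<close>, so \<open>x\<close> preserves
    \<open>?Q\<close>.\<close>
  have "colon ?Q ?Q = T"
  proof (rule max)
    show "lattice_ring (colon ?Q ?Q)"
      unfolding lattice_ring_def
      using unital_subring_colon_self[OF full_lattice_subspace[OF Q]] full_lattice_colon[OF Q Q] by blast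
    show "T \<subseteq> colon ?Q ?Q" using T'(3) by (auto simp: colon_def mult.assoc)
  qed
  moreover have "colon T V \<subseteq> colon ?Q ?Q"
  proof
    fix x assume x: "x \<in> colon T V"
    have "x * q * u \<in> T" if "q \<in> ?Q" "u \<in> U" for q u
    proof -
      have "x * (u * q) \<in> T" using x ideal_prodI[OF that(2,1)] by (auto simp: colon_def V_def)
      then show ?thesis by (simp add: ac_simps)
    qed
    then show "x \<in> colon ?Q ?Q" by (auto simp: colon_def)
  qed
  ultimately have TV: "colon T V \<subseteq> T" by simp
  obtain N where N: "N > 0" "\<forall>x\<in>T. int_scale N x \<in> V"
    using full_lattice_common_multiple[OF V latT] by blast
  define F where "F = int_scale N ` T"
  have F_mult: "x * t \<in> F" if "t \<in> T" "x \<in> F" for t x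
    using that T'(3) unfolding F_def by (auto simp: int_scale_def mult.assoc)
  have F: "int_module.subspace F"
  proof (rule int_module.subspaceI)
    show "0 \<in> F" unfolding F_def using int_module.subspace_0[OF T'(2)] by force
  next
    fix x y assume "x \<in> F" "y \<in> F"
    then show "x + y \<in> F"
      unfolding F_def using int_module.subspace_add[OF T'(2)]
      by (auto simp flip: int_module.scale_right_distrib)
  next
    fix c x assume "x \<in> F"
    then obtain t where t: "t \<in> T" "x = int_scale N t" by (auto simp: F_def)
    have "int_scale c x = int_scale N (int_scale c t)" unfolding t by (simp add: mult.commute)
    then show "int_scale c x \<in> F"
      unfolding F_def using int_module.subspace_scale[OF T'(2) t(1)] by blast
  qed
  have FV: "F \<subseteq> V" using N unfolding F_def by auto
  obtain X where X: "finite X" "T = int_module.span X" using latT by (auto simp: full_lattice_def)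
  have index: "finite_index F T" unfolding F_def X(2) by (rule finite_index_int_scale[OF X(1) N(1)])
  \<comment> \<open>The descent runs over \<open>1 - e\<close> with \<open>e\<close> in
    \<open>V\<close>; reaching \<open>F\<close>, which lies in \<open>V\<close>, means that 1 is in
    \<open>V\<close>.\<close>
  define C where "C = {1 - e | e. e \<in> V}"
  have "\<exists>c\<in>C. c \<in> F"
  proof (rule finite_quotient_descent[OF ringT F _ F_mult index])
    show "F \<subseteq> T" using FV VT by blast
    show "C \<subseteq> T" unfolding C_def using VT int_module.subspace_diff[OF T'(2) T'(1)] by blast
    show "C \<noteq> {}" unfolding C_def using int_module.subspace_0[OF Vsub] by blast
  next
    fix c y assume "c \<in> C" and y: "y \<in> T" "y \<notin> F"
      and min: "\<And>z. z \<in> T \<Longrightarrow> y * z \<notin> F \<Longrightarrow> \<exists>t\<in>T. y - y * z * t \<in> F"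
    then obtain e where e: "e \<in> V" "c = 1 - e" by (auto simp: C_def)
    have "\<exists>v\<in>V. y * v \<notin> F"
    proof (rule ccontr)
      assume no: "\<not> ?thesis"
      \<comment> \<open>If \<open>V\<close> annihilated \<open>y\<close> modulo \<open>N T\<close>,
        then \<open>y / N\<close> would lie in \<open>(T:V)\<close>, hence in \<open>T\<close>, and
        \<open>y\<close> would be in \<open>F = N T\<close>.\<close>
      define y' where "y' = scl (1 / of_int N) y"
      have y': "int_scale N y' = y" using N by (simp add: y'_def flip: scl_of_int)
      have "y' * v \<in> T" if v: "v \<in> V" for v
      proof -
        obtain t where t: "t \<in> T" "y * v = int_scale N t" using no v by (auto simp: F_def)
        then have "scl (of_int N) (y' * v) = scl (of_int N) t"
          using y' by (simp flip: scl_mult add: scl_of_int)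
        with N t show ?thesis by simp
      qed
      then have "y' \<in> T" using TV by (auto simp: colon_def)
      with y' y show False by (auto simp: F_def)
    qed
    then obtain v where v: "v \<in> V" "y * v \<notin> F" by blast
    with min[of v] VT obtain t where t: "t \<in> T" "y - y * v * t \<in> F" by blast
    have vt: "v * t \<in> V" using Vmult v t by blast
    have "c * (1 - v * t) = 1 - (e + (v * t - v * t * e))"
      unfolding e by (simp add: algebra_simps)
    moreover have "e + (v * t - v * t * e) \<in> V"
      using e vt Vmult[OF vt, of e] VT
      by (intro int_module.subspace_add[OF Vsub] int_module.subspace_diff[OF Vsub]) auto
    ultimately have "c * (1 - v * t) \<in> C" unfolding C_def by blast
    moreover have "y * (1 - v * t) \<in> F" using t(2) by (simp add: algebra_simps)
    moreover have "1 - v * t \<in> T" using vt VT int_module.subspace_diff[OF T'(2) T'(1)] by blast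
    ultimately show "\<exists>d\<in>T. c * d \<in> C \<and> y * d \<in> F" by blast
  qed
  then obtain e where e: "e \<in> V" "1 - e \<in> V" using FV by (auto simp: C_def)
  from int_module.subspace_add[OF Vsub this] show ?thesis by (simp add: V_def)
qed

lemma suitable_over_order_iff:
  assumes "lattice_ring S"
  shows "suitable_over_order scl S T \<longleftrightarrow> lattice_ring T \<and> S \<subseteq> T \<and>
    1 \<in> ideal_prod (ideal_prod (trace_dual scl S) T) (colon T (ideal_prod (trace_dual scl S) T))"
  unfolding suitable_over_order_def Let_def over_order_lattice_ring_iff[OF assms] by blast

lemma suitable_over_order_exists:
  assumes S: "lattice_ring S"
  shows "\<exists>T. suitable_over_order scl S T"
proof -
  obtain T where T: "lattice_ring T" "S \<subseteq> T" "\<And>D. lattice_ring D \<Longrightarrow> T \<subseteq> D \<Longrightarrow> D = T"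
    using maximal_over_order_exists[OF S] by blast
  have "full_lattice (ideal_prod (trace_dual scl S) T)"
    using S T(1) by (intro full_lattice_ideal_prod trace_dual_full_lattice) (auto simp: lattice_ring_def)
  from maximal_order_invertible[OF T(1,3) this] T show ?thesis
    using suitable_over_order_iff[OF S] by blast
qed

section \<open>Correctness of the output\<close>

lemma colon_finite_index:
  assumes "lattice_ring S" "lattice_ring T"
  shows "finite_index (colon S T) T"
  using assms full_lattice_finite_index full_lattice_colon unfolding lattice_ring_def by blast

lemma candidate_ideal_covers:
  assumes S: "lattice_ring S" and T: "suitable_over_order scl S T"
    and I: "full_lattice I" "colon I I = S"
  obtains H where "H \<in> quotient_subgroups S T" "weakly_equivalent (candidate_ideal S T H) I"
proof -
  have ringS: "unital_subring S" using S by (simp add: lattice_ring_def)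
  have T': "lattice_ring T" "unital_subring T" "S \<subseteq> T"
    using T suitable_over_order_iff[OF S] by (auto simp: lattice_ring_def)
  have mult: "s * x \<in> I" if "s \<in> S" "x \<in> I" for s x
    using that I(2) by (auto simp: colon_def)
  have inv: "1 \<in> ideal_prod (ideal_prod I T) (colon T (ideal_prod I T))"
    using extension_invertible[OF I T'(2)] T suitable_over_order_iff[OF S] by blast
  obtain J where J: "int_module.subspace J" "\<And>s x. s \<in> S \<Longrightarrow> x \<in> J \<Longrightarrow> s * x \<in> J"
    "colon S T \<subseteq> J" "J \<subseteq> T" "weakly_equivalent J I"
    using weakly_equivalent_between[OF ringS T'(2,3) colon_finite_index[OF S T'(1)] mult
        full_lattice_subspace[OF I(1)] inv] by blast
  have "submodule_over S J"
    using J(1,2) int_module.subspace_0 int_module.subspace_add unfolding submodule_over_def by blast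
  from candidate_ideal_surj[OF ringS T'(2,3) this J(3,4)] J(5) that show thesis by metis
qed

text \<open>Stated for any \<open>test\<close> that accepts the ideals with multiplicator ring
  \<open>S\<close>, so as to cover both the unrestricted loop and the restricted one. Filtering
  afterwards loses no class, because weakly equivalent ideals share their multiplicator
  ring.\<close>

lemma algorithm_output_correct:
  assumes R: "unital_subring R" "finite B" "R = int_module.span B"
    and S: "lattice_ring S" "R \<subseteq> S"
    and test: "\<And>I. colon I I = S \<Longrightarrow> test I"
    and out: "algorithm_output scl test S L"
  shows "\<forall>I\<in>set L. fractional_ideal scl R I \<and> S \<subseteq> colon I I \<and> test I"
    and "sorted_wrt (\<lambda>I J. \<not> weakly_equivalent I J) L"
    and "list_of_representatives (filter (\<lambda>I. colon I I = S) L) (weak_classes scl R S)"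
proof -
  have ringS: "unital_subring S" and latS: "full_lattice S" using S by (auto simp: lattice_ring_def)
  have SS: "colon S S = S" by (rule colon_self_of_subring[OF ringS])
  have frac: "fractional_ideal scl R I" if "full_lattice I" "submodule_over S I" for I
    using that S(2) unfolding fractional_ideal_iff[OF R] by (auto simp: submodule_over_def)
  have colon_S: "S \<subseteq> colon I I" if "submodule_over S I" for I
    using that by (auto simp: submodule_over_def colon_def)
  have "(\<forall>I\<in>set L. full_lattice I \<and> submodule_over S I \<and> test I)
    \<and> sorted_wrt (\<lambda>I J. \<not> weakly_equivalent I J) L
    \<and> (\<forall>I. full_lattice I \<longrightarrow> colon I I = S \<longrightarrow> (\<exists>J\<in>set L. weakly_equivalent J I))"
    using out
  proof cases
    case trace_dual_invertible
    have "submodule_over S S" using submodule_over_unital_iff[OF ringS] by blast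
    moreover have "weakly_equivalent S I" if I: "full_lattice I" "colon I I = S" for I
    proof -
      have mult: "s * x \<in> I" if "s \<in> S" "x \<in> I" for s x
        using that I(2) by (auto simp: colon_def)
      have IS: "ideal_prod I S = I"
        using full_lattice_subspace[OF I(1)] unital_subringD(1)[OF ringS] mult
        by (rule ideal_prod_unital)
      have "s * x \<in> trace_dual scl S" if s: "s \<in> S" and x: "x \<in> trace_dual scl S" for s x
      proof -
        have "alg_trace scl (x * (s * y)) \<in> \<int>" if "y \<in> S" for y
          using x unital_subringD(3)[OF ringS s that] by (simp add: trace_dual_def)
        then show ?thesis by (simp add: trace_dual_def ac_simps)
      qed
      then have "ideal_prod (trace_dual scl S) S = trace_dual scl S"
        using unital_subringD(1)[OF ringS] by (intro ideal_prod_unital subspace_trace_dual)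
      \<comment> \<open>The transfer of invertibility with \<open>T = S\<close>, where both products
        with \<open>S\<close> collapse. As \<open>I\<close> lies in \<open>(I:S)\<close>, an
        expression of 1 in \<open>I (S:I)\<close> already witnesses weak equivalence with
        \<open>S\<close>.\<close>
      then have "1 \<in> ideal_prod I (colon S I)"
        using extension_invertible[OF I ringS] trace_dual_invertible(2) IS by simp
      moreover have "x * s \<in> I" if "s \<in> S" "x \<in> I" for s x
        using mult[OF that] by (simp add: mult.commute)
      then have "I \<subseteq> colon I S" by (auto simp: colon_def)
      ultimately show ?thesis
        using ideal_prod_mono[of I "colon I S" "colon S I" "colon S I"]
          weakly_equivalent_sym[of I S]
        unfolding weakly_equivalent_def by blast
    qed
    ultimately show ?thesis using trace_dual_invertible(1) latS test[OF SS] by auto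
  next
    case (trace_dual_not_invertible T Hs)
    have T: "lattice_ring T" "unital_subring T" "S \<subseteq> T"
      using trace_dual_not_invertible(3) suitable_over_order_iff[OF S(1)] by (auto simp: lattice_ring_def)
    let ?Is = "map (candidate_ideal S T) Hs"
    note fold = foldl_append_if_new[where ?L0.0 = "[]" and test = test and Is = ?Is, folded trace_dual_not_invertible(1), simplified]
    have cand: "full_lattice (candidate_ideal S T H)" "submodule_over S (candidate_ideal S T H)"
      if "H \<in> set Hs" for H
    proof -
      have "H \<in> quotient_subgroups S T" using that trace_dual_not_invertible(5) by simp
      note bounds = candidate_ideal_bounds[OF ringS T(2,3) this]
      show "submodule_over S (candidate_ideal S T H)" by (rule bounds)
      have "full_lattice T" using T(1) by (simp add: lattice_ring_def)
      then show "full_lattice (candidate_ideal S T H)"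
        using full_lattice_intermediate[OF full_lattice_colon[OF latS \<open>full_lattice T\<close>] \<open>full_lattice T\<close>
            submodule_over_imp_subspace[OF ringS bounds(1)] bounds(2,3)] by blast
    qed
    have "\<exists>J\<in>set L. weakly_equivalent J I" if I: "full_lattice I" "colon I I = S" for I
    proof -
      obtain H where H: "H \<in> set Hs" "weakly_equivalent (candidate_ideal S T H) I"
        using candidate_ideal_covers[OF S(1) trace_dual_not_invertible(3) I] trace_dual_not_invertible(5)
        by blast
      \<comment> \<open>Weak equivalence with \<open>I\<close> forces multiplicator ring
        \<open>S\<close>, so the candidate passes \<open>test\<close>; the entry of \<open>L\<close>
        representing it is then equivalent to \<open>I\<close> by transitivity.\<close>
      have "colon (candidate_ideal S T H) (candidate_ideal S T H) = S"
        using weakly_equivalent_colon_self_eq[OF H(2)] cand(1)[OF H(1)] I full_lattice_subspace by blast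
      then obtain J where "J \<in> set L" "weakly_equivalent J (candidate_ideal S T H)"
        using fold H(1) test by blast
      then show ?thesis using weakly_equivalent_trans H(2) by blast
    qed
    then show ?thesis using fold cand by blast
  qed
  then have *: "\<And>I. I \<in> set L \<Longrightarrow> full_lattice I \<and> submodule_over S I \<and> test I"
    "sorted_wrt (\<lambda>I J. \<not> weakly_equivalent I J) L"
    "\<And>I. full_lattice I \<Longrightarrow> colon I I = S \<Longrightarrow> \<exists>J\<in>set L. weakly_equivalent J I"
    by blast+
  show "\<forall>I\<in>set L. fractional_ideal scl R I \<and> S \<subseteq> colon I I \<and> test I"
    using *(1) frac colon_S by blast
  show "sorted_wrt (\<lambda>I J. \<not> weakly_equivalent I J) L" by (rule *(2))
  show "list_of_representatives (filter (\<lambda>I. colon I I = S) L) (weak_classes scl R S)"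
  proof (rule list_of_representatives_weak_classes)
    show "sorted_wrt (\<lambda>I J. \<not> weakly_equivalent I J) (filter (\<lambda>I. colon I I = S) L)"
      using *(2) by (rule sorted_wrt_filter)
    show "set (filter (\<lambda>I. colon I I = S) L) \<subseteq> ideals_with_multiplicator_ring scl R S"
      using *(1) frac by (auto simp: ideals_with_multiplicator_ring_def)
    fix I assume "I \<in> ideals_with_multiplicator_ring scl R S"
    then have I: "full_lattice I" "colon I I = S"
      by (auto simp: ideals_with_multiplicator_ring_def fractional_ideal_iff[OF R])
    with *(3) obtain J where J: "J \<in> set L" "weakly_equivalent J I" by blast
    have "colon J J = S"
      using weakly_equivalent_colon_self_eq[OF J(2)] *(1)[OF J(1)] I full_lattice_subspace by blast
    with J show "\<exists>J\<in>set (filter (\<lambda>I. colon I I = S) L). weakly_equivalent J I" by auto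
  qed
qed

end

(* The four conjuncts: a suitable T exists; the loop is finite; outcome of the loop exactly as
   described; outcome of the loop restricted to ideals with multiplicator ring S. *)
theorem theorem6p3:
  fixes scl :: "rat \<Rightarrow> 'k::comm_ring_1 \<Rightarrow> 'k" and R S :: "'k set"
  assumes "etale_algebra scl"
    and "order_in_algebra R"
    and "over_order scl R S"
  shows
    "(\<exists>T. suitable_over_order scl S T) \<and>
     (\<forall>T. suitable_over_order scl S T \<longrightarrow> finite (quotient_subgroups S T)) \<and>
     (\<forall>L. algorithm_output scl (\<lambda>I. True) S L \<longrightarrow>
        (\<forall>I\<in>set L. fractional_ideal scl R I \<and> S \<subseteq> colon I I) \<and>
        (\<forall>i<length L. \<forall>j<length L. i \<noteq> j \<longrightarrow> \<not> weakly_equivalent (L ! i) (L ! j)) \<and>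
        list_of_representatives (filter (\<lambda>I. colon I I = S) L) (weak_classes scl R S)) \<and>
     (\<forall>L. algorithm_output scl (\<lambda>I. colon I I = S) S L \<longrightarrow>
        list_of_representatives L (weak_classes scl R S))"
proof -
  interpret etale_algebra scl by fact
  have int_scale_eq: "(\<lambda>n x. of_int n * x) = (int_scale :: int \<Rightarrow> 'k \<Rightarrow> 'k)"
    by (simp add: fun_eq_iff int_scale_def)
  obtain B where R: "unital_subring R" "finite B" "R = int_module.span B"
    using assms(2) unfolding order_in_algebra_def int_scale_eq by blast
  have S: "lattice_ring S" "R \<subseteq> S" using assms(3) over_order_iff[OF R] by auto
  show ?thesis
  proof (intro conjI allI impI)
    show "\<exists>T. suitable_over_order scl S T" by (rule suitable_over_order_exists[OF S(1)])
    show "finite (quotient_subgroups S T)" if "suitable_over_order scl S T" for T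
      using that suitable_over_order_iff[OF S(1)] S(1) colon_finite_index finite_quotient_subgroups
      unfolding lattice_ring_def by blast
  next
    fix L assume "algorithm_output scl (\<lambda>I. True) S L"
    note out = algorithm_output_correct[OF R S TrueI this]
    show "\<forall>I\<in>set L. fractional_ideal scl R I \<and> S \<subseteq> colon I I" using out(1) by blast
    show "\<not> weakly_equivalent (L ! i) (L ! j)" if "i < length L" "j < length L" "i \<noteq> j" for i j
      using sorted_wrt_inequivalent_nth[OF out(2) that] .
    show "list_of_representatives (filter (\<lambda>I. colon I I = S) L) (weak_classes scl R S)"
      by (rule out(3))
  next
    fix L assume "algorithm_output scl (\<lambda>I. colon I I = S) S L"
    note out = algorithm_output_correct[OF R S _ this]
    \<comment> \<open>Every appended ideal has passed the test, which here is the filter condition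
      itself.\<close>
    have "filter (\<lambda>I. colon I I = S) L = L" using out(1) by (simp add: filter_id_conv)
    then show "list_of_representatives L (weak_classes scl R S)" using out(3) by simp
  qed
qed

end
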